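(* Let $d\ge 2$. (1) If $d\le 5$, then for every irreducible fraction $r/s$ with $s>0$: $\Phi_d(q)$ divides $\mathcal{S}_{r/s}(q)$ if and only if $s\equiv 0$ and $r\equiv\pm1\pmod d$; if moreover $d\le 4$, this is equivalent to $d\mid s$. Likewise, $\Phi_d(q)$ divides $\mathcal{R}_{r/s}(q)$ if and only if $r\equiv 0$ and $s\equiv\pm1\pmod d$; if moreover $d\le 4$, this is equivalent to $d\mid r$. (2) If $d\ge 6$, then $\langle R\rangle N_d$ has infinite index in $\Gamma=\mathrm{PSL}(2,\mathbb{Z})$, and there is an irreducible fraction $r/s$ with $s>0$, $s\equiv0$ and $r\equiv\pm1\pmod d$ such that $\Phi_d(q)$ does not divide $\mathcal{S}_{r/s}(q)$. Likewise, there is an irreducible fraction $r/s$ with $s>0$, $r\equiv 0$ and $s\equiv\pm1\pmod d$ such that $\Phi_d(q)$ does not divide $\mathcal{R}_{r/s}(q)$.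
   Context: $q$-deformed rationals: every irreducible fraction $r/s>1$ has a unique Hirzebruch--Jung expansion $r/s=[\![c_1,\dots,c_k]\!]=c_1-\cfrac{1}{c_2-\cfrac{1}{\ddots-\cfrac{1}{c_k}}}$ with all $c_i\ge 2$ integers. Put $R_q=\begin{pmatrix}q&1\\0&1\end{pmatrix}$, $S_q=\begin{pmatrix}0&-q^{-1}\\1&0\end{pmatrix}$ and $M_q(c_1,\dots,c_k)=R_q^{c_1}S_q\cdots R_q^{c_k}S_q$. For $r/s=[\![c_1,\dots,c_k]\!]>1$, the polynomials $\mathcal{R}_{r/s}(q),\mathcal{S}_{r/s}(q)\in\mathbb{Z}[q]$ are the upper and lower entries of the first column of $M_q(c_1,\dots,c_k)$, and $[r/s]_q=\mathcal{R}_{r/s}(q)/\mathcal{S}_{r/s}(q)$. This is extended to $\mathbb{Q}\cup\{\infty\}$ by $[\alpha+1]_q=q[\alpha]_q+1$, $[0/1]_q=0$, $[1/0]_q=1/0$. For an arbitrary irreducible fraction $r/s$ with $s>0$, $\mathcal{R}_{r/s}(q)$ and $\mathcal{S}_{r/s}(q)$ are the coprime Laurent polynomials with integer coefficients such that $[r/s]_q=\mathcal{R}_{r/s}(q)/\mathcal{S}_{r/s}(q)$, $\mathcal{S}_{r/s}(q)\in\mathbb{Z}[q]$ and $\mathcal{S}_{r/s}(0)=1$. Divisibility of Laurent polynomials is in $\mathbb{Z}[q^{\pm1}]$. $\Phi_d(q)$ is the $d$-th cyclotomic polynomial. Modular group: $R$ is the image of $\begin{pmatrix}1&1\\0&1\end{pmatrix}$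 in $\Gamma=\mathrm{PSL}(2,\mathbb{Z})$, and $N_d$ is the normal closure of $R^d$ in $\Gamma$; $\langle R\rangle N_d$ is a subgroup of $\Gamma$. *)

theory Defs
  imports
    "HOL-Analysis.Analysis"
    "HOL-Algebra.Generated_Groups"
    "HOL-Computational_Algebra.Polynomial"
    "HOL-Computational_Algebra.Fraction_Field"
    "HOL-Computational_Algebra.Fundamental_Theorem_Algebra"
    "HOL-Library.Poly_Mapping"
    "HOL-Number_Theory.Cong"
begin

unbundle no fps_syntax

text \<open>
  The ring of integral Laurent polynomials is the monoid algebra of the additive group of the
  integers: a finitely supported map sends an exponent to its coefficient, and multiplication is
  convolution. Hence \<^term>\<open>(dvd)\<close> on this type is divisibility of Laurent polynomials.
\<close>

type_synonym laurent = "int \<Rightarrow>\<^sub>0 int"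

abbreviation qpow :: "int \<Rightarrow> laurent" where
  "qpow k \<equiv> Poly_Mapping.single k 1"

definition laurent_of_poly :: "int poly \<Rightarrow> laurent" where
  "laurent_of_poly p = poly (map_poly of_int p) (qpow 1)"

text \<open>The library constant \<open>coprime\<close> requires a division operation; this is its definition.\<close>

definition coprime_laurent :: "laurent \<Rightarrow> laurent \<Rightarrow> bool" where
  "coprime_laurent a b \<longleftrightarrow> (\<forall>c. c dvd a \<longrightarrow> c dvd b \<longrightarrow> c dvd 1)"


fun hj_val :: "nat list \<Rightarrow> rat" where
  "hj_val [] = 0"
| "hj_val [c] = of_nat c"
| "hj_val (c # cs) = of_nat c - 1 / hj_val cs"

definition is_hj :: "nat list \<Rightarrow> bool" where
  "is_hj cs \<longleftrightarrow> cs \<noteq> [] \<and> (\<forall>c\<in>set cs. c \<ge> 2)"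

definition hj_expansion :: "rat \<Rightarrow> nat list" where
  "hj_expansion \<alpha> = (THE cs. is_hj cs \<and> hj_val cs = \<alpha>)"


definition R_q :: "laurent^2^2" where
  "R_q = vector [vector [qpow 1, 1], vector [0, 1]]"

definition S_q :: "laurent^2^2" where
  "S_q = vector [vector [0, - qpow (- 1)], vector [1, 0]]"

text \<open>The power \<open>R_q\<^sup>c\<close> is an iterated matrix product, since \<open>^\<close> on vectors is componentwise.\<close>

fun M_q :: "nat list \<Rightarrow> laurent^2^2" where
  "M_q [] = mat 1"
| "M_q (c # cs) = (((**) R_q ^^ c) (mat 1) ** S_q) ** M_q cs"

text \<open>
  The recursion below reads \<open>[\<alpha> + 1]\<^sub>q = q [\<alpha>]\<^sub>q + 1\<close> from right to left for \<open>\<alpha> \<le> 1\<close>. That the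
  resulting function satisfies this identity everywhere, and \<open>[0]\<^sub>q = 0\<close>, is proved in
  \<open>qrat_add_1\<close> and \<open>qrat_0\<close>. The value at infinity is not needed for fractions with positive
  denominator.
\<close>

function qrat :: "rat \<Rightarrow> laurent fract" where
  "qrat \<alpha> = (if \<alpha> > 1
     then (let M = M_q (hj_expansion \<alpha>) in Fraction_Field.Fract (M $ 1 $ 1) (M $ 2 $ 1))
     else (qrat (\<alpha> + 1) - 1) / Fraction_Field.Fract (qpow 1) 1)"
  by auto
termination
proof (relation "Wellfounded.measure (\<lambda>\<alpha>. nat \<lceil>2 - \<alpha>\<rceil>)", goal_cases)
  case (2 \<alpha>)
  have "\<lceil>2 - (\<alpha> + 1)\<rceil> = \<lceil>2 - \<alpha>\<rceil> - 1"
    by (simp add: ceiling_diff_one [symmetric] algebra_simps del: ceiling_diff_one)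
  moreover have "\<lceil>2 - \<alpha>\<rceil> > 0" using 2 by simp
  ultimately show ?case by simp
qed simp

declare qrat.simps [simp del]

definition is_qrat_pair :: "rat \<Rightarrow> laurent \<Rightarrow> laurent \<Rightarrow> bool" where
  "is_qrat_pair \<alpha> R S \<longleftrightarrow> coprime_laurent R S
     \<and> (\<exists>p. S = laurent_of_poly p \<and> poly p 0 = 1)
     \<and> qrat \<alpha> = Fraction_Field.Fract R S"

definition qnum :: "rat \<Rightarrow> laurent" where
  "qnum \<alpha> = fst (THE (R, S). is_qrat_pair \<alpha> R S)"

definition qden :: "rat \<Rightarrow> laurent" where
  "qden \<alpha> = snd (THE (R, S). is_qrat_pair \<alpha> R S)"


definition primitive_roots_unity :: "nat \<Rightarrow> complex set" where
  "primitive_roots_unity d = {z. z ^ d = 1 \<and> (\<forall>k. 0 < k \<and> k < d \<longrightarrow> z ^ k \<noteq> 1)}"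

definition cyclotomic :: "nat \<Rightarrow> int poly" where
  "cyclotomic d = (THE p. map_poly of_int p = (\<Prod>z\<in>primitive_roots_unity d. [:- z, 1:]))"


definition SL2Z :: "(int^2^2) monoid" where
  "SL2Z = \<lparr>carrier = {A. det A = 1}, mult = (**), one = mat 1\<rparr>"

definition PSL2Z :: "(int^2^2) set monoid" where
  "PSL2Z = SL2Z Mod {mat 1, - mat 1}"

definition R_PSL :: "(int^2^2) set" where
  "R_PSL = {mat 1, - mat 1} #>\<^bsub>SL2Z\<^esub> vector [vector [1, 1], vector [0, 1]]"

definition normal_closure :: "('a, 'b) monoid_scheme \<Rightarrow> 'a set \<Rightarrow> 'a set" where
  "normal_closure G A =
     generate G {g \<otimes>\<^bsub>G\<^esub> a \<otimes>\<^bsub>G\<^esub> inv\<^bsub>G\<^esub> g | g a. g \<in> carrier G \<and> a \<in> A}"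

definition N_sub :: "nat \<Rightarrow> (int^2^2) set set" where
  "N_sub d = normal_closure PSL2Z {R_PSL [^]\<^bsub>PSL2Z\<^esub> d}"


subsection \<open>The definite descriptions above denote\<close>

text \<open>
  Every rational above 1 has a unique expansion (\<open>hj_expansion\<close>, \<open>is_hj_inj\<close>), every rational has
  a unique normalized pair (\<open>is_qrat_pair_qnum_qden\<close>, \<open>qnum_qden_eqI\<close>), which above 1 is the first
  column of the matrix (\<open>qnum_qden_gt_1\<close>), and the product over the primitive roots of unity has
  integer coefficients (\<open>map_poly_cyclotomic\<close>).
\<close>

lemma is_hj_val_bounds:
  assumes "is_hj (c # cs)"
  shows "of_nat c - 1 < hj_val (c # cs)" "hj_val (c # cs) \<le> of_nat c"
proof -
  have "of_nat c - 1 < hj_val (c # cs) \<and> hj_val (c # cs) \<le> of_nat c"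
    using assms
  proof (induction cs arbitrary: c)
    case (Cons d cs)
    have "is_hj (d # cs)" "2 \<le> d" using Cons.prems by (auto simp: is_hj_def)
    with Cons.IH[of d] have "hj_val (d # cs) > 1"
      using of_nat_mono[of 2 d, where 'a = rat] by auto
    then show ?case by (simp add: field_simps)
  qed (auto simp: is_hj_def)
  then show "of_nat c - 1 < hj_val (c # cs)" "hj_val (c # cs) \<le> of_nat c" by auto
qed

lemma is_hj_val_gt_1: "is_hj cs \<Longrightarrow> hj_val cs > 1"
proof (cases cs)
  case (Cons c cs')
  assume *: "is_hj cs"
  then have "(2::rat) \<le> of_nat c" by (auto simp: is_hj_def Cons)
  with is_hj_val_bounds(1)[of c cs'] * Cons show ?thesis by simp
qed (simp add: is_hj_def)

lemma is_hj_inj: "is_hj cs \<Longrightarrow> is_hj ds \<Longrightarrow> hj_val cs = hj_val ds \<Longrightarrow> cs = ds"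
proof (induction cs arbitrary: ds)
  case (Cons c cs)
  obtain d es where ds: "ds = d # es" using Cons.prems by (cases ds) (auto simp: is_hj_def)
  have "\<lceil>hj_val (c # cs)\<rceil> = int c"
    using is_hj_val_bounds[OF Cons.prems(1)] by (simp add: ceiling_eq_iff)
  moreover have "\<lceil>hj_val (d # es)\<rceil> = int d"
    using is_hj_val_bounds[of d es] Cons.prems(2) ds by (simp add: ceiling_eq_iff)
  ultimately have cd: "c = d" using Cons.prems(3) ds by simp
  have tl: "is_hj xs" if "is_hj (x # xs)" "xs \<noteq> []" for x xs
    using that by (auto simp: is_hj_def)
  show ?case
  proof (cases "cs = [] \<or> es = []")
    case True
    have "\<not> (hj_val (x # xs) = of_nat x \<and> is_hj (x # xs) \<and> xs \<noteq> [])" for x xs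
      using is_hj_val_gt_1[OF tl, of x xs] by (cases xs) auto
    then show ?thesis using True Cons.prems cd ds by (metis hj_val.simps(2))
  next
    case False
    then have "hj_val (c # cs) = of_nat c - 1 / hj_val cs"
      "hj_val (d # es) = of_nat d - 1 / hj_val es"
      by (cases cs; cases es; simp)+
    then have "hj_val cs = hj_val es" using Cons.prems(3) cd ds by simp
    then show ?thesis using Cons.IH[of es] False Cons.prems tl cd ds by blast
  qed
qed (simp add: is_hj_def)

lemma is_hj_exists_aux:
  fixes r s :: int
  assumes "0 < s" "s < r"
  shows "\<exists>cs. is_hj cs \<and> hj_val cs = of_int r / of_int s"
  using assms
proof (induction "nat s" arbitrary: r s rule: less_induct)
  case less
  define c where "c = - ((- r) div s)"
  have c: "c * s = r + (- r) mod s"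
    unfolding c_def using div_mult_mod_eq[of "- r" s] by linarith
  have m: "0 \<le> (- r) mod s" "(- r) mod s < s" using less.prems by auto
  have "c * s > 1 * s" using c m less.prems by linarith
  then have c2: "c \<ge> 2" using less.prems mult_less_cancel_right_pos[of s 1 c] by linarith
  show ?case
  proof (cases "(- r) mod s = 0")
    case True
    have "of_int (c * s) = (of_int r :: rat)" using c True by simp
    then have "of_int r / of_int s = (of_int c :: rat)" using less.prems by (simp add: field_simps)
    then show ?thesis using c2 by (intro exI[of _ "[nat c]"]) (simp add: is_hj_def)
  next
    case False
    define t where "t = (- r) mod s"
    have t: "0 < t" "t < s" using m False by (auto simp: t_def)
    then obtain cs where cs: "is_hj cs" "hj_val cs = of_int s / of_int t"
      using less.hyps[of t s] by auto
    have r: "r = c * s - t" using c by (simp add: t_def)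
    from cs have "hj_val (nat c # cs) = of_nat (nat c) - 1 / hj_val cs"
      by (cases cs) (auto simp: is_hj_def)
    also have "\<dots> = of_int r / of_int s" using cs(2) c2 t unfolding r cs(2) by (simp add: field_simps)
    finally show ?thesis using c2 cs by (intro exI[of _ "nat c # cs"]) (auto simp: is_hj_def)
  qed
qed

lemma is_hj_exists:
  assumes "\<alpha> > 1" shows "\<exists>cs. is_hj cs \<and> hj_val cs = \<alpha>"
proof -
  obtain r s where "\<alpha> = Rat.Fract r s" "s > 0" by (cases \<alpha>) auto
  then have a: "\<alpha> = of_int r / of_int s" by (simp add: Fract_of_int_quotient)
  with assms \<open>s > 0\<close> have "s < r" by (simp add: field_simps)
  with is_hj_exists_aux[OF \<open>s > 0\<close> this] a show ?thesis by simp
qed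

lemma hj_expansion:
  assumes "\<alpha> > 1" shows "is_hj (hj_expansion \<alpha>)" "hj_val (hj_expansion \<alpha>) = \<alpha>"
proof -
  have "\<exists>!cs. is_hj cs \<and> hj_val cs = \<alpha>" using is_hj_exists[OF assms] is_hj_inj by metis
  from theI'[OF this] show "is_hj (hj_expansion \<alpha>)" "hj_val (hj_expansion \<alpha>) = \<alpha>"
    unfolding hj_expansion_def by auto
qed

lemma hj_expansion_eqI: "is_hj cs \<Longrightarrow> hj_val cs = \<alpha> \<Longrightarrow> hj_expansion \<alpha> = cs"
  unfolding hj_expansion_def using is_hj_inj by (intro the_equality) auto

lemma qpow_mult: "qpow i * qpow j = qpow (i + j)"
  by (simp add: mult_single)

lemma qpow_0: "qpow 0 = 1" by simp

lemma qpow_power: "qpow 1 ^ n = qpow (int n)"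
  by (induction n) (simp_all add: mult_single)

lemma laurent_of_poly_simps [simp]:
  "laurent_of_poly 0 = 0" "laurent_of_poly 1 = 1"
  "laurent_of_poly (p + p') = laurent_of_poly p + laurent_of_poly p'"
  "laurent_of_poly (p - p') = laurent_of_poly p - laurent_of_poly p'"
  "laurent_of_poly (- p) = - laurent_of_poly p"
  "laurent_of_poly (p * p') = laurent_of_poly p * laurent_of_poly p'"
proof -
  have add: "map_poly of_int (p + p') = (map_poly of_int p + map_poly of_int p' :: laurent poly)" for p p'
    by (intro poly_eqI) (simp add: coeff_map_poly)
  have uminus: "map_poly of_int (- p) = (- map_poly of_int p :: laurent poly)" for p
    by (intro poly_eqI) (simp add: coeff_map_poly)
  have mult: "map_poly of_int (p * p') = (map_poly of_int p * map_poly of_int p' :: laurent poly)" for p p'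
    by (intro poly_eqI) (simp add: coeff_map_poly coeff_mult)
  show "laurent_of_poly 0 = 0" "laurent_of_poly 1 = 1"
    "laurent_of_poly (- p) = - laurent_of_poly p"
    "laurent_of_poly (p + p') = laurent_of_poly p + laurent_of_poly p'"
    "laurent_of_poly (p * p') = laurent_of_poly p * laurent_of_poly p'"
    by (simp_all add: laurent_of_poly_def add mult uminus)
  have "laurent_of_poly (p + - p') = laurent_of_poly p + - laurent_of_poly p'"
    unfolding laurent_of_poly_def add uminus by simp
  then show "laurent_of_poly (p - p') = laurent_of_poly p - laurent_of_poly p'"
    by simp
qed

lemma laurent_of_poly_pCons:
  "laurent_of_poly (pCons a p) = of_int a + qpow 1 * laurent_of_poly p"
proof -
  have "map_poly of_int (pCons a p) = pCons (of_int a) (map_poly of_int p :: laurent poly)"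
    by (intro poly_eqI) (simp add: coeff_map_poly coeff_pCons split: nat.split)
  then show ?thesis by (simp add: laurent_of_poly_def)
qed

lemma lookup_qpow_mult: "Poly_Mapping.lookup (qpow i * x) k = Poly_Mapping.lookup x (k - i)"
proof -
  have eq: "(k = l + m) = (m = k - l)" for l m :: int by auto
  have "Poly_Mapping.lookup (qpow i * x) k = Sum_any (\<lambda>l. Poly_Mapping.lookup (qpow i) l * Poly_Mapping.lookup x (k - l))"
    by (simp add: lookup_mult eq)
  also have "\<dots> = Sum_any (\<lambda>l. Poly_Mapping.lookup x (k - l) when i = l)"
    by (intro arg_cong[of _ _ Sum_any] ext) (simp add: lookup_single when_def)
  finally show ?thesis by simp
qed

lemma lookup_laurent_of_poly:
  "Poly_Mapping.lookup (laurent_of_poly p) k = (if k \<ge> 0 then coeff p (nat k) else 0)"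
proof (induction p arbitrary: k)
  case (pCons a p)
  have "nat k = Suc (nat (k - 1))" if "k > 0" using that by auto
  then show ?case
    by (auto simp: laurent_of_poly_pCons lookup_add lookup_qpow_mult pCons.IH
      lookup_single simp flip: single_of_int) 
qed simp

lemma laurent_of_poly_inj: "laurent_of_poly p = laurent_of_poly p' \<longleftrightarrow> p = p'"
proof
  assume "laurent_of_poly p = laurent_of_poly p'"
  then have "coeff p n = coeff p' n" for n
    using lookup_laurent_of_poly[of p "int n"] lookup_laurent_of_poly[of p' "int n"] by simp
  then show "p = p'" by (intro poly_eqI)
qed simp

lemma laurent_of_poly_nonzero: "poly p 0 = 1 \<Longrightarrow> laurent_of_poly p \<noteq> 0"
  using laurent_of_poly_inj[of p 0] by auto

lemma laurent_eq_shifted_poly: "\<exists>n p. qpow (int n) * x = laurent_of_poly p"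
proof -
  have mono: "laurent_of_poly (monom 1 n) = qpow (int n)" for n
    by (intro poly_mapping_eqI) (auto simp: lookup_laurent_of_poly lookup_single when_def)
  have *: "\<exists>p. qpow (int m) * y = laurent_of_poly p"
    if "qpow (int n) * y = laurent_of_poly p" "n \<le> m" for n m y p
  proof -
    have "qpow (int m) = laurent_of_poly (monom 1 (m - n)) * qpow (int n)"
      using that(2) by (simp add: mono qpow_mult)
    then show ?thesis using that(1) by (metis laurent_of_poly_simps(6) mult.assoc)
  qed
  have "Poly_Mapping.keys x \<subseteq> UNIV" by simp
  then show ?thesis
  proof (induction x rule: frag_induction)
    case zero
    show ?case by (intro exI[of _ 0]) simp
  next
    case (one i)
    have "qpow (int (nat (- i))) * qpow i = laurent_of_poly (monom 1 (nat (int (nat (- i)) + i)))"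
      by (simp add: qpow_mult mono)
    then show ?case by blast
  next
    case (diff a b)
    then obtain n m p p' where
      "qpow (int n) * a = laurent_of_poly p" "qpow (int m) * b = laurent_of_poly p'" by blast
    with *[of n a p "max n m"] *[of m b p' "max n m"] obtain p1 p2 where
      "qpow (int (max n m)) * a = laurent_of_poly p1" "qpow (int (max n m)) * b = laurent_of_poly p2"
      by auto
    then have "qpow (int (max n m)) * (a - b) = laurent_of_poly (p1 - p2)"
      by (simp add: right_diff_distrib)
    then show ?case by blast
  qed
qed

lemma X_power_dvd_cancel:
  fixes u t :: "int poly"
  assumes "[:0, 1:] ^ n dvd u * t" "poly t 0 = 1"
  shows "[:0, 1:] ^ n dvd u"
  using assms(1)
proof (induction n arbitrary: u)
  case (Suc n)
  have X: "[:0, 1:] dvd p \<longleftrightarrow> poly p 0 = 0" for p :: "int poly"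
    using poly_eq_0_iff_dvd[of p 0] by simp
  have "[:0, 1:] dvd u * t" using Suc.prems by (metis dvd_mult_left power_Suc)
  then have "poly u 0 = 0" using assms(2) by (simp add: X)
  then obtain u' where u': "u = [:0, 1:] * u'" using X by (metis dvdE)
  have "[:0, 1:] * [:0, 1:] ^ n dvd [:0, 1:] * (u' * t)"
    using Suc.prems by (simp add: u' mult.assoc)
  then have "[:0, 1:] ^ n dvd u' * t" by (subst (asm) dvd_mult_cancel_left) auto
  then have "[:0, 1:] ^ n dvd u'" by (rule Suc.IH)
  then show ?case unfolding u' power_Suc by (rule mult_dvd_mono[OF dvd_refl])
qed simp

lemma laurent_dvd_imp_poly_dvd:
  assumes "laurent_of_poly t dvd laurent_of_poly t'" "poly t 0 = 1"
  shows "t dvd t'"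
proof -
  obtain x where x: "laurent_of_poly t' = laurent_of_poly t * x" using assms(1) by (elim dvdE)
  obtain n u where u: "qpow (int n) * x = laurent_of_poly u" using laurent_eq_shifted_poly by blast
  have X: "laurent_of_poly ([:0, 1:] ^ m) = qpow (int m)" for m
  proof (induction m)
    case (Suc m)
    have "laurent_of_poly [:0, 1:] = qpow 1" by (simp add: laurent_of_poly_pCons)
    with Suc show ?case by (simp add: qpow_mult del: mult_pCons_left)
  qed simp
  have "laurent_of_poly ([:0, 1:] ^ n * t') = laurent_of_poly (u * t)"
    by (simp add: X x ac_simps flip: u)
  then have eq: "[:0, 1:] ^ n * t' = u * t" by (simp only: laurent_of_poly_inj)
  then have "[:0, 1:] ^ n dvd u * t" by (metis dvd_triv_left)
  then have "[:0, 1:] ^ n dvd u" using assms(2) by (rule X_power_dvd_cancel)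
  then obtain u' where "u = [:0, 1:] ^ n * u'" by (elim dvdE)
  with eq have "t' = u' * t" by simp
  then show ?thesis by simp
qed

lemma normalized_poly_dvd_antisym:
  fixes t t' :: "int poly"
  assumes "t dvd t'" "t' dvd t" "poly t 0 = 1" "poly t' 0 = 1"
  shows "t = t'"
proof -
  obtain u v where u: "t' = t * u" and v: "t = t' * v" using assms(1,2) by (metis dvdE)
  have "t * (u * v) = t * 1" using u v by (metis mult.assoc mult_1_right)
  moreover have "t \<noteq> 0" using assms(3) by auto
  ultimately have "u * v = 1" by (simp only: mult_cancel_left) simp
  then have "degree u = 0"
    by (metis add_is_0 degree_1 degree_mult_eq mult_zero_left mult_zero_right one_neq_zero)
  then obtain c where c: "u = [:c:]" by (rule degree_eq_zeroE)
  have "poly u 0 = 1" using assms(3,4) u by simp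
  then show ?thesis using u c by simp
qed

text \<open>A stronger form of coprimality that the continued fraction matrices provide.\<close>

definition bezout_laurent :: "laurent \<Rightarrow> laurent \<Rightarrow> bool" where
  "bezout_laurent a b \<longleftrightarrow> (\<exists>x y. x * a + y * b = 1)"

lemma bezout_imp_coprime_laurent: "bezout_laurent a b \<Longrightarrow> coprime_laurent a b"
  unfolding bezout_laurent_def coprime_laurent_def by (metis dvd_add dvd_mult)

lemma is_qrat_pair_unique:
  assumes "is_qrat_pair \<alpha> a b" "bezout_laurent a b" "is_qrat_pair \<alpha> a' b'"
  shows "a = a' \<and> b = b'"
proof -
  obtain p p' where p: "b = laurent_of_poly p" "poly p 0 = 1" and p': "b' = laurent_of_poly p'" "poly p' 0 = 1"
    using assms unfolding is_qrat_pair_def by blast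
  have nz: "b \<noteq> 0" "b' \<noteq> 0"
    using laurent_of_poly_nonzero p p' by simp_all
  have "Fraction_Field.Fract a b = Fraction_Field.Fract a' b'" using assms by (simp add: is_qrat_pair_def)
  then have eq: "a * b' = a' * b" using nz by (simp add: eq_fract)
  obtain x y where xy: "x * a + y * b = 1" using assms(2) by (auto simp: bezout_laurent_def)
  define u where "u = x * a' + y * b'"
  have "b' = (x * a + y * b) * b'" using xy by simp
  also have "\<dots> = x * (a * b') + y * b * b'" by (simp add: algebra_simps)
  also have "\<dots> = u * b" unfolding u_def eq by (simp add: algebra_simps)
  finally have b': "b' = u * b" .
  have "b * a' = a' * b" by (rule mult.commute)
  also have "\<dots> = b * (u * a)" unfolding eq[symmetric] b' by (simp only: ac_simps)
  finally have a': "a' = u * a" using nz by simp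
  have "u dvd 1" using assms(3) a' b' unfolding is_qrat_pair_def coprime_laurent_def by auto
  then obtain v where v: "1 = u * v" by (elim dvdE)
  have "v * b' = (u * v) * b" unfolding b' by (simp only: ac_simps)
  then have "b = v * b'" by (simp flip: v)
  then have "b' dvd b" by (metis dvd_triv_right)
  moreover have "b dvd b'" unfolding b' by simp
  ultimately have "p = p'"
    using p p' normalized_poly_dvd_antisym[of p p'] laurent_dvd_imp_poly_dvd by blast
  then have bb: "b = b'" using p p' by simp
  with b' nz have "u = 1" by simp
  with bb a' show ?thesis by simp
qed

lemma R_q_power: "((**) R_q ^^ c) (mat 1) =
   vector [vector [qpow (int c), \<Sum>i<c. qpow (int i)], vector [0, 1]]"
proof (induction c)
  case 0
  show ?case by (simp add: vec_eq_iff forall_2 mat_def)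
next
  case (Suc c)
  have "(\<Sum>i<Suc c. qpow (int i)) = 1 + qpow 1 * (\<Sum>i<c. qpow (int i))"
    by (subst sum.lessThan_Suc_shift) (simp add: sum_distrib_left qpow_mult)
  then show ?case
    unfolding funpow.simps o_apply Suc.IH
    by (simp add: R_q_def vec_eq_iff forall_2 matrix_matrix_mult_def sum_2 qpow_mult add.commute)
qed

lemma M_q_Nil:
  "M_q [] $ 1 $ 1 = 1" "M_q [] $ 1 $ 2 = 0" "M_q [] $ 2 $ 1 = 0" "M_q [] $ 2 $ 2 = 1"
  by (simp_all add: mat_def)

lemma M_q_Cons:
  "M_q (c # cs) $ 1 $ j = (\<Sum>i<c. qpow (int i)) * M_q cs $ 1 $ j - qpow (int c - 1) * M_q cs $ 2 $ j"
  "M_q (c # cs) $ 2 $ j = M_q cs $ 1 $ j"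
  by (simp_all add: R_q_power S_q_def matrix_matrix_mult_def sum_2 qpow_mult)

declare M_q.simps [simp del]

lemma M_q_Suc_Cons:
  "M_q (Suc c # cs) $ 1 $ j = qpow 1 * M_q (c # cs) $ 1 $ j + M_q (c # cs) $ 2 $ j"
  "M_q (Suc c # cs) $ 2 $ j = M_q (c # cs) $ 2 $ j"
proof -
  have sum: "(\<Sum>i<Suc c. qpow (int i)) = 1 + qpow 1 * (\<Sum>i<c. qpow (int i))"
    by (subst sum.lessThan_Suc_shift) (simp add: sum_distrib_left qpow_mult)
  have pow: "qpow (int (Suc c) - 1) = qpow 1 * qpow (int c - 1)" by (simp add: qpow_mult)
  show "M_q (Suc c # cs) $ 1 $ j = qpow 1 * M_q (c # cs) $ 1 $ j + M_q (c # cs) $ 2 $ j"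
    unfolding M_q_Cons sum pow by (simp add: algebra_simps)
qed (simp add: M_q_Cons)

lemma M_q_column_poly:
  assumes "\<forall>c\<in>set cs. c \<ge> 2"
  shows "\<exists>p t. M_q cs $ 1 $ 1 = laurent_of_poly p \<and> poly p 0 = 1
    \<and> M_q cs $ 2 $ 1 = laurent_of_poly t \<and> (cs \<noteq> [] \<longrightarrow> poly t 0 = 1)"
  using assms
proof (induction cs)
  case Nil
  show ?case by (rule exI[of _ 1], rule exI[of _ 0]) (simp add: M_q_Nil)
next
  case (Cons c cs)
  then obtain p t where p: "M_q cs $ 1 $ 1 = laurent_of_poly p" "poly p 0 = 1"
    and t: "M_q cs $ 2 $ 1 = laurent_of_poly t" by auto
  have c: "c \<ge> 2" using Cons.prems by simp
  have mono: "laurent_of_poly (monom 1 n) = qpow (int n)" for n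
    by (intro poly_mapping_eqI) (auto simp: lookup_laurent_of_poly lookup_single when_def)
  have sum: "(\<Sum>i<n. qpow (int i)) = laurent_of_poly (\<Sum>i<n. monom 1 i)" for n
    by (induction n) (simp_all add: mono)
  have "poly (\<Sum>i<c. monom 1 i) (0::int) = (\<Sum>i<c. 0 ^ i)" by (simp add: poly_sum poly_monom)
  also have "\<dots> = (\<Sum>i<Suc (c - 1). 0 ^ i)" using c by simp
  also have "\<dots> = 1" by (simp only: sum.lessThan_Suc_shift) simp
  finally have "poly ((\<Sum>i<c. monom 1 i) * p - monom 1 (c - 1) * t) 0 = 1"
    using p c by (simp add: poly_monom zero_power)
  moreover have "M_q (c # cs) $ 1 $ 1 = laurent_of_poly ((\<Sum>i<c. monom 1 i) * p - monom 1 (c - 1) * t)"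
    using c by (simp add: M_q_Cons p t sum mono of_nat_diff)
  moreover have "M_q (c # cs) $ 2 $ 1 = laurent_of_poly p" by (simp add: M_q_Cons p)
  ultimately show ?case using p(2) by blast
qed

lemma M_q_det:
  assumes "\<forall>c\<in>set cs. c \<ge> 2"
  shows "\<exists>k. M_q cs $ 1 $ 1 * M_q cs $ 2 $ 2 - M_q cs $ 1 $ 2 * M_q cs $ 2 $ 1 = qpow k"
  using assms
proof (induction cs)
  case Nil
  show ?case by (intro exI[of _ 0]) (simp add: M_q_Nil)
next
  case (Cons c cs)
  then obtain k where k: "M_q cs $ 1 $ 1 * M_q cs $ 2 $ 2 - M_q cs $ 1 $ 2 * M_q cs $ 2 $ 1 = qpow k" by auto
  have alg: "(g * x - r * y) * z - (g * z - r * w) * x = r * (x * w - z * y)" for g r x y z w :: laurent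
    by (simp add: algebra_simps)
  from k have "M_q (c # cs) $ 1 $ 1 * M_q (c # cs) $ 2 $ 2 - M_q (c # cs) $ 1 $ 2 * M_q (c # cs) $ 2 $ 1
    = qpow (int c - 1) * qpow k"
    by (simp only: M_q_Cons alg)
  then show ?case by (auto simp: qpow_mult)
qed

lemma M_q_bezout:
  assumes "\<forall>c\<in>set cs. c \<ge> 2"
  shows "bezout_laurent (M_q cs $ 1 $ 1) (M_q cs $ 2 $ 1)"
proof -
  obtain k where k: "M_q cs $ 1 $ 1 * M_q cs $ 2 $ 2 - M_q cs $ 1 $ 2 * M_q cs $ 2 $ 1 = qpow k"
    using M_q_det[OF assms] by blast
  have "(qpow (- k) * M_q cs $ 2 $ 2) * M_q cs $ 1 $ 1 + (- qpow (- k) * M_q cs $ 1 $ 2) * M_q cs $ 2 $ 1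
    = qpow (- k) * (M_q cs $ 1 $ 1 * M_q cs $ 2 $ 2 - M_q cs $ 1 $ 2 * M_q cs $ 2 $ 1)"
    by (simp add: algebra_simps)
  also have "\<dots> = 1" by (simp add: k qpow_mult)
  finally show ?thesis unfolding bezout_laurent_def by blast
qed

lemma qrat_gt_1:
  "\<alpha> > 1 \<Longrightarrow> qrat \<alpha> = Fraction_Field.Fract (M_q (hj_expansion \<alpha>) $ 1 $ 1) (M_q (hj_expansion \<alpha>) $ 2 $ 1)"
  by (subst qrat.simps) (simp add: Let_def)

lemma M_q_is_qrat_pair:
  assumes "\<alpha> > 1"
  shows "is_qrat_pair \<alpha> (M_q (hj_expansion \<alpha>) $ 1 $ 1) (M_q (hj_expansion \<alpha>) $ 2 $ 1)"
  using hj_expansion(1)[OF assms] M_q_column_poly[of "hj_expansion \<alpha>"]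
    bezout_imp_coprime_laurent[OF M_q_bezout[of "hj_expansion \<alpha>"]] qrat_gt_1[OF assms]
  unfolding is_hj_def is_qrat_pair_def by blast

lemma q_fract_nonzero: "Fraction_Field.Fract (qpow 1) 1 \<noteq> 0"
  by (simp add: Zero_fract_def eq_fract)

lemma qrat_add_1: "qrat (\<alpha> + 1) = Fraction_Field.Fract (qpow 1) 1 * qrat \<alpha> + 1"
proof (cases "\<alpha> > 1")
  case False
  then show ?thesis by (subst (2) qrat.simps) (simp add: q_fract_nonzero)
next
  case True
  obtain c cs where cs: "hj_expansion \<alpha> = c # cs"
    using hj_expansion(1)[OF True] by (cases "hj_expansion \<alpha>") (auto simp: is_hj_def)
  have "is_hj (c # cs)" "hj_val (c # cs) = \<alpha>" using hj_expansion[OF True] cs by simp_all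
  then have "is_hj (Suc c # cs)" "hj_val (Suc c # cs) = \<alpha> + 1"
    by (auto simp: is_hj_def) (cases cs; simp)
  then have e: "hj_expansion (\<alpha> + 1) = Suc c # cs" by (rule hj_expansion_eqI)
  have "M_q (c # cs) $ 2 $ 1 \<noteq> 0"
    using M_q_is_qrat_pair[OF True] laurent_of_poly_nonzero unfolding is_qrat_pair_def cs by metis
  then show ?thesis
    using True e qrat_gt_1[of "\<alpha> + 1"]
    by (simp add: qrat_gt_1[of \<alpha>] cs M_q_Suc_Cons One_fract_def ac_simps)
qed

lemma qrat_0: "qrat 0 = 0"
proof -
  have "hj_expansion 2 = [2]" by (intro hj_expansion_eqI) (auto simp: is_hj_def)
  then have "qrat 2 = Fraction_Field.Fract (1 + qpow 1) 1"
    by (simp add: qrat_gt_1 M_q_Cons M_q_Nil numeral_2_eq_2)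
  also have "\<dots> = Fraction_Field.Fract (qpow 1) 1 * 1 + 1"
    by (simp add: One_fract_def add.commute)
  finally have "Fraction_Field.Fract (qpow 1) 1 * qrat 1 = Fraction_Field.Fract (qpow 1) 1 * 1"
    using qrat_add_1[of 1] by simp
  then have "qrat 1 = 1" by (simp only: mult_cancel_left q_fract_nonzero) simp
  then show ?thesis using qrat_add_1[of 0] q_fract_nonzero by simp
qed

lemma is_qrat_pair_exists: "\<exists>a b. is_qrat_pair \<alpha> a b \<and> bezout_laurent a b"
proof (induction \<alpha> rule: qrat.induct)
  case (1 \<alpha>)
  show ?case
  proof (cases "\<alpha> > 1")
    case True
    then show ?thesis
      using M_q_is_qrat_pair M_q_bezout hj_expansion(1) unfolding is_hj_def by blast
  next
    case False
    then obtain a b where ab: "is_qrat_pair (\<alpha> + 1) a b" "bezout_laurent a b" using 1 by blast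
    obtain x y where xy: "x * a + y * b = 1" using ab(2) by (auto simp: bezout_laurent_def)
    define a' where "a' = qpow (- 1) * (a - b)"
    have a: "a = qpow 1 * a' + b" by (simp add: a'_def qpow_mult flip: mult.assoc)
    have "(x * qpow 1) * a' + (x + y) * b = 1" using xy by (simp add: a algebra_simps)
    then have bez: "bezout_laurent a' b" unfolding bezout_laurent_def by blast
    have "b \<noteq> 0" using ab(1) laurent_of_poly_nonzero unfolding is_qrat_pair_def by metis
    then have "Fraction_Field.Fract (qpow 1) 1 * Fraction_Field.Fract a' b + 1 = Fraction_Field.Fract a b"
      by (simp add: One_fract_def a ac_simps)
    also have "\<dots> = Fraction_Field.Fract (qpow 1) 1 * qrat \<alpha> + 1"
      using ab(1) by (simp add: is_qrat_pair_def qrat_add_1)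
    finally have "Fraction_Field.Fract (qpow 1) 1 * Fraction_Field.Fract a' b
        = Fraction_Field.Fract (qpow 1) 1 * qrat \<alpha>" by (simp only: add_right_cancel)
    then have "qrat \<alpha> = Fraction_Field.Fract a' b"
      by (simp only: mult_cancel_left q_fract_nonzero) simp
    then have "is_qrat_pair \<alpha> a' b"
      using ab(1) bezout_imp_coprime_laurent[OF bez] by (simp add: is_qrat_pair_def)
    with bez show ?thesis by blast
  qed
qed

lemma qnum_qden_eqI:
  assumes "is_qrat_pair \<alpha> a b" shows "qnum \<alpha> = a" "qden \<alpha> = b"
proof -
  obtain a0 b0 where "is_qrat_pair \<alpha> a0 b0" "bezout_laurent a0 b0"
    using is_qrat_pair_exists by blast
  then have u: "a' = a0 \<and> b' = b0" if "is_qrat_pair \<alpha> a' b'" for a' b'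
    using is_qrat_pair_unique that by blast
  have "(THE (R, S). is_qrat_pair \<alpha> R S) = (a, b)"
  proof (rule the_equality)
    show "case (a, b) of (R, S) \<Rightarrow> is_qrat_pair \<alpha> R S" using assms by simp
    show "x = (a, b)" if "case x of (R, S) \<Rightarrow> is_qrat_pair \<alpha> R S" for x
    proof (cases x)
      case (Pair a' b')
      then have "is_qrat_pair \<alpha> a' b'" using that by simp
      from u[OF this] u[OF assms] show ?thesis by (simp add: Pair)
    qed
  qed
  then show "qnum \<alpha> = a" "qden \<alpha> = b" by (simp_all add: qnum_def qden_def)
qed

lemma is_qrat_pair_qnum_qden: "is_qrat_pair \<alpha> (qnum \<alpha>) (qden \<alpha>)"
  using is_qrat_pair_exists qnum_qden_eqI by metis

lemma qnum_qden_gt_1: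
  assumes "\<alpha> > 1"
  shows "qnum \<alpha> = M_q (hj_expansion \<alpha>) $ 1 $ 1" "qden \<alpha> = M_q (hj_expansion \<alpha>) $ 2 $ 1"
  using qnum_qden_eqI[OF M_q_is_qrat_pair[OF assms]] by simp_all

lemma map_poly_of_int_hom:
  "map_poly of_int (p + p' :: int poly) = (map_poly of_int p + map_poly of_int p' :: complex poly)"
  "map_poly of_int (p - p' :: int poly) = (map_poly of_int p - map_poly of_int p' :: complex poly)"
  "map_poly of_int (p * p' :: int poly) = (map_poly of_int p * map_poly of_int p' :: complex poly)"
  by (intro poly_eqI; simp add: coeff_map_poly coeff_mult)+

lemma map_poly_of_int_inj:
  assumes "map_poly of_int p = (map_poly of_int p' :: complex poly)" shows "p = p'"
proof (rule poly_eqI)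
  fix n
  have "coeff (map_poly of_int p :: complex poly) n = coeff (map_poly of_int p') n" using assms by simp
  then show "coeff p n = coeff p' n" by (simp add: coeff_map_poly)
qed

lemma prod_primitive_roots_unity:
  assumes "d > 0"
  shows "(\<Prod>e | e dvd d. \<Prod>z\<in>primitive_roots_unity e. [:- z, 1:]) = monom 1 d - 1"
proof -
  let ?U = "{z::complex. z ^ d = 1}"
  have finU: "finite {z::complex. z ^ e = 1}" if "e dvd d" for e
    using that assms by (intro finite_roots_unity) (auto dest: dvd_imp_le intro!: Nat.gr0I)
  have U: "?U = (\<Union>e\<in>{e. e dvd d}. primitive_roots_unity e)"
  proof (intro equalityI subsetI)
    fix z assume "z \<in> ?U"
    then have zd: "z ^ d = 1" by simp
    define e where "e = (LEAST k. 0 < k \<and> z ^ k = 1)"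
    have e: "0 < e" "z ^ e = 1"
      using LeastI[of "\<lambda>k. 0 < k \<and> z ^ k = 1" d] assms zd by (auto simp: e_def)
    have min: "z ^ k \<noteq> 1" if "0 < k" "k < e" for k
      using not_less_Least[of k "\<lambda>k. 0 < k \<and> z ^ k = 1"] that by (auto simp: e_def)
    have "z ^ d = (z ^ e) ^ (d div e) * z ^ (d mod e)"
      by (simp flip: power_mult power_add)
    then have "z ^ (d mod e) = 1" using zd e by simp
    then have "d mod e = 0" using min[of "d mod e"] e by (cases "d mod e = 0") auto
    then have "e dvd d" by (simp add: dvd_eq_mod_eq_0)
    then show "z \<in> (\<Union>e\<in>{e. e dvd d}. primitive_roots_unity e)"
      using e min by (auto simp: primitive_roots_unity_def)
  next
    fix z assume "z \<in> (\<Union>e\<in>{e. e dvd d}. primitive_roots_unity e)"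
    then show "z \<in> ?U" by (auto simp: primitive_roots_unity_def power_mult elim!: dvdE)
  qed
  have disj: "primitive_roots_unity e \<inter> primitive_roots_unity e' = {}"
    if "e dvd d" "e' dvd d" "e \<noteq> e'" for e e'
  proof -
    have "e > 0" "e' > 0" using that assms by (auto intro!: Nat.gr0I)
    then show ?thesis using that(3) by (cases e e' rule: linorder_cases) (auto simp: primitive_roots_unity_def)
  qed
  have rsq: "rsquarefree (monom 1 d - 1 :: complex poly)"
    unfolding rsquarefree_roots using assms
    by (auto simp: pderiv_diff pderiv_monom poly_monom power_0_left)
  have lc: "lead_coeff (monom 1 d - 1 :: complex poly) = 1"
  proof -
    have "degree (monom 1 d - 1 :: complex poly) = d"
      using assms by (subst diff_conv_add_uminus, subst degree_add_eq_left) (auto simp: degree_monom_eq)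
    then show ?thesis using assms by simp
  qed
  have "monom 1 d - 1 = (\<Prod>z | poly (monom 1 d - 1) z = 0. [:- z, 1:] :: complex poly)"
    using complex_poly_decompose_rsquarefree[OF rsq] lc by simp
  also have "{z. poly (monom 1 d - 1 :: complex poly) z = 0} = ?U" by (simp add: poly_monom)
  also have "(\<Prod>z\<in>?U. [:- z, 1:]) = (\<Prod>e | e dvd d. \<Prod>z\<in>primitive_roots_unity e. [:- z, 1:])"
    unfolding U
  proof (rule prod.UNION_disjoint)
    show "finite {e. e dvd d}" using assms by simp
    show "\<forall>e\<in>{e. e dvd d}. finite (primitive_roots_unity e)"
      using finU by (auto simp: primitive_roots_unity_def)
  qed (use disj in auto)
  finally show ?thesis by simp
qed

lemma ex1_cyclotomic:
  assumes "d > 0"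
  shows "\<exists>!p. map_poly of_int p = (\<Prod>z\<in>primitive_roots_unity d. [:- z, 1:])"
proof -
  define F where "F e = (\<Prod>z\<in>primitive_roots_unity e. [:- z, 1:])" for e
  have "\<exists>p. map_poly of_int p = F d" using assms
  proof (induction d rule: less_induct)
    case (less d)
    define D where "D = {e. e dvd d} - {d}"
    have D: "finite D" using less.prems by (simp add: D_def)
    have "\<exists>p. map_poly of_int p = F e" if "e \<in> D" for e
      using that less by (auto simp: D_def dest: dvd_imp_le intro!: less.IH Nat.gr0I)
    then obtain P where P: "map_poly of_int (P e) = F e" if "e \<in> D" for e by metis
    define Q where "Q = (\<Prod>e\<in>D. P e)"
    have "map_poly of_int (\<Prod>e\<in>E. P e) = (\<Prod>e\<in>E. F e)" if "E \<subseteq> D" for E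
      using finite_subset[OF that D] that
      by (induction E rule: finite_induct) (simp_all add: map_poly_of_int_hom P)
    then have Q: "map_poly of_int Q = (\<Prod>e\<in>D. F e)" by (simp add: Q_def)
    have deg: "degree (map_poly of_int p :: complex poly) = degree p" for p :: "int poly"
      by (rule degree_map_poly) simp
    have "lead_coeff (map_poly of_int Q :: complex poly) = 1"
      by (simp add: Q F_def lead_coeff_prod)
    then have monic: "lead_coeff Q = 1" by (simp add: deg coeff_map_poly)
    then have "Q \<noteq> 0" by auto
    obtain a r where ar: "pseudo_divmod (monom 1 d - 1) Q = (a, r)" by fastforce
    have eq: "monom 1 d - 1 = Q * a + r" and r: "r = 0 \<or> degree r < degree Q"
      using pseudo_divmod[OF \<open>Q \<noteq> 0\<close> ar] monic by simp_all
    have "{e. e dvd d} = insert d D" "d \<notin> D" by (auto simp: D_def)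
    then have "(monom 1 d - 1 :: complex poly) = F d * (\<Prod>e\<in>D. F e)"
      using prod_primitive_roots_unity[OF less.prems] D by (simp add: F_def)
    also have "(monom 1 d - 1 :: complex poly) = map_poly of_int (monom 1 d - 1)"
      by (simp add: map_poly_of_int_hom map_poly_monom)
    also have "\<dots> = map_poly of_int Q * map_poly of_int a + map_poly of_int r"
      by (simp only: eq map_poly_of_int_hom)
    finally have *: "map_poly of_int Q * (F d - map_poly of_int a) = map_poly of_int r"
      by (simp add: Q algebra_simps)
    have "F d = map_poly of_int a"
    proof (rule ccontr)
      assume "F d \<noteq> map_poly of_int a"
      then have nz: "F d - map_poly of_int a \<noteq> 0" by simp
      have Qnz: "map_poly of_int Q \<noteq> (0::complex poly)"
        using \<open>lead_coeff (map_poly of_int Q :: complex poly) = 1\<close> by auto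
      have "degree Q \<le> degree r"
        using degree_mult_eq[OF Qnz nz] unfolding * deg by simp
      moreover have "r \<noteq> 0" using * Qnz nz by (metis map_poly_0 mult_eq_0_iff)
      ultimately show False using r by simp
    qed
    then show ?case by metis
  qed
  then show ?thesis unfolding F_def using map_poly_of_int_inj by metis
qed

lemma map_poly_cyclotomic:
  assumes "d > 0"
  shows "map_poly of_int (cyclotomic d) = (\<Prod>z\<in>primitive_roots_unity d. [:- z, 1:])"
  unfolding cyclotomic_def by (rule theI'[OF ex1_cyclotomic[OF assms]])

lemma det_uminus_2: "det (- A) = det (A :: int^2^2)"
  by (simp add: det_2)

lemma group_SL2Z: "group SL2Z"
proof (rule groupI)
  fix A assume "A \<in> carrier SL2Z"
  then have d: "A $ 1 $ 1 * A $ 2 $ 2 - A $ 1 $ 2 * A $ 2 $ 1 = 1" by (simp add: SL2Z_def det_2)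
  define B :: "int^2^2" where "B = vector [vector [A $ 2 $ 2, - A $ 1 $ 2], vector [- A $ 2 $ 1, A $ 1 $ 1]]"
  have "det B = 1" using d by (simp add: B_def det_2 mult.commute)
  moreover have "B ** A = mat 1"
    using d by (simp add: B_def vec_eq_iff forall_2 matrix_matrix_mult_def sum_2 mat_def mult.commute)
  ultimately show "\<exists>B\<in>carrier SL2Z. B \<otimes>\<^bsub>SL2Z\<^esub> A = \<one>\<^bsub>SL2Z\<^esub>"
    by (auto simp: SL2Z_def)
qed (auto simp: SL2Z_def det_mul matrix_mul_assoc)

lemma normal_center_SL2Z: "{mat 1, - mat 1} \<lhd> SL2Z"
proof -
  interpret group SL2Z by (rule group_SL2Z)
  have neg: "- mat 1 ** A = - A" "A ** - mat 1 = - A" for A :: "int^2^2"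
    by (simp_all add: vec_eq_iff forall_2 matrix_matrix_mult_def sum_2 mat_def)
  have inv: "inv\<^bsub>SL2Z\<^esub> (- mat 1) = - mat 1"
    by (rule inv_equality) (auto simp: SL2Z_def neg det_uminus_2)
  have inv1: "inv\<^bsub>SL2Z\<^esub> (mat 1) = mat 1"
    by (rule inv_equality) (auto simp: SL2Z_def)
  have "subgroup {mat 1, - mat 1} SL2Z"
  proof (rule subgroupI)
    show "{mat 1, - mat 1} \<subseteq> carrier SL2Z" by (auto simp: SL2Z_def det_uminus_2)
    show "inv\<^bsub>SL2Z\<^esub> A \<in> {mat 1, - mat 1}" if "A \<in> {mat 1, - mat 1}" for A
      using that inv inv1 by auto
    show "A \<otimes>\<^bsub>SL2Z\<^esub> B \<in> {mat 1, - mat 1}" if "A \<in> {mat 1, - mat 1}" "B \<in> {mat 1, - mat 1}" for A B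
      using that by (auto simp: SL2Z_def neg)
  qed simp
  then show ?thesis
    by (rule normalI) (auto simp: SL2Z_def r_coset_def l_coset_def neg)
qed

lemma group_PSL2Z: "group PSL2Z"
  unfolding PSL2Z_def by (rule normal.factorgroup_is_group[OF normal_center_SL2Z])

lemma R_PSL_in_carrier: "R_PSL \<in> carrier PSL2Z"
proof -
  have "vector [vector [1, 1], vector [0, 1]] \<in> carrier SL2Z" by (simp add: SL2Z_def det_2)
  then show ?thesis unfolding PSL2Z_def R_PSL_def FactGroup_def RCOSETS_def by auto
qed

end

theory Submission
  imports Defs
begin

text \<open>
  A Laurent polynomial is divisible by \<open>\<Phi>\<^sub>d\<close> iff it vanishes at every primitive \<open>d\<close>-th root of unity \<open>z\<close>.
  Specializing \<open>q = z\<close> turns \<open>[r/s]\<^sub>q\<close> into a point of the complex projective line, and the map from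
  fractions to points is equivariant: \<open>R\<close> acts on points as \<open>w \<mapsto> z w + 1\<close>, of order \<open>d\<close>, and \<open>S\<close> as
  \<open>w \<mapsto> - 1 / (z w)\<close>. The denominator vanishes iff the point is infinity, the numerator iff it is 0.

  For \<open>d \<le> 5\<close> the orbit of infinity is finite (the vertices of a triangle, tetrahedron, octahedron or
  icosahedron), and the point depends only on \<open>(r, s)\<close> modulo \<open>d\<close> and sign, so it can be tabulated.

  For \<open>d \<ge> 6\<close> take \<open>z = e\<^bsup>2\<pi>i/d\<^esup>\<close>. The element \<open>R\<^sup>3 S\<close> acts on points with normalized trace
  \<open>1 + z + 1 / z \<ge> 2\<close>, so no positive power of it maps infinity to infinity, although some positive power is
  trivial modulo \<open>d\<close>. On the other hand \<open>N\<^sub>d\<close> acts trivially on points and \<open>R\<close> fixes infinity, so the powers of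
  \<open>R\<^sup>3 S\<close> lie in distinct cosets of \<open>\<langle>R\<rangle> N\<^sub>d\<close>.
\<close>

subsection \<open>Evaluation of Laurent polynomials and divisibility by cyclotomic polynomials\<close>

text \<open>Negative exponents are cleared by a power of q, the resulting integer polynomial is
  evaluated, and the power is divided out again. For nonzero \<open>z\<close> the choice of the
  power is immaterial by \<open>laurent_eval_eqI\<close>.\<close>

definition laurent_eval :: "complex \<Rightarrow> laurent \<Rightarrow> complex" where
  "laurent_eval z x = (let (n, p) = (SOME (n, p). qpow (int n) * x = laurent_of_poly p)
     in poly (map_poly of_int p) z / z ^ n)"

lemma laurent_of_poly_monom: "laurent_of_poly (monom 1 n) = qpow (int n)"
  by (intro poly_mapping_eqI) (auto simp: lookup_laurent_of_poly lookup_single when_def)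

text \<open>Two ways of clearing exponents agree after multiplying each polynomial by the monomial
  of the other, and this is an identity of ordinary polynomials because
  \<open>laurent_of_poly\<close> is injective.\<close>

lemma laurent_eval_eqI:
  assumes "z \<noteq> 0" "qpow (int n) * x = laurent_of_poly p"
  shows "laurent_eval z x = poly (map_poly of_int p) z / z ^ n"
proof -
  obtain m p' where *: "(SOME (n, p). qpow (int n) * x = laurent_of_poly p) = (m, p')"
    by (meson surj_pair)
  have "case (SOME (n, p). qpow (int n) * x = laurent_of_poly p) of
      (n, p) \<Rightarrow> qpow (int n) * x = laurent_of_poly p"
    by (rule someI[of "\<lambda>(n, p). qpow (int n) * x = laurent_of_poly p" "(n, p)"]) (simp add: assms)
  then have m: "qpow (int m) * x = laurent_of_poly p'" by (simp add: *)
  have "laurent_of_poly (monom 1 n * p') = laurent_of_poly (monom 1 m * p)"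
    by (simp add: laurent_of_poly_monom ac_simps flip: m assms(2))
  then have "monom 1 n * p' = monom 1 m * p" by (simp only: laurent_of_poly_inj)
  then have "poly (map_poly of_int (monom 1 n * p')) z = poly (map_poly of_int (monom 1 m * p)) z"
    by simp
  then have "z ^ n * poly (map_poly of_int p') z = z ^ m * poly (map_poly of_int p) z"
    by (simp add: map_poly_of_int_hom map_poly_monom poly_monom)
  then show ?thesis unfolding laurent_eval_def * using assms(1) by (simp add: field_simps)
qed

lemma laurent_eval_of_poly:
  "z \<noteq> 0 \<Longrightarrow> laurent_eval z (laurent_of_poly p) = poly (map_poly of_int p) z"
  using laurent_eval_eqI[of z 0 "laurent_of_poly p" p] by simp

lemma laurent_eval_mult:
  assumes "z \<noteq> 0" shows "laurent_eval z (x * y) = laurent_eval z x * laurent_eval z y"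
proof -
  obtain n p m p' where *: "qpow (int n) * x = laurent_of_poly p" "qpow (int m) * y = laurent_of_poly p'"
    using laurent_eq_shifted_poly by metis
  have "qpow (int (n + m)) * (x * y) = laurent_of_poly (p * p')"
    by (simp add: ac_simps flip: * qpow_mult)
  from laurent_eval_eqI[OF assms this] show ?thesis
    by (simp add: laurent_eval_eqI[OF assms *(1)] laurent_eval_eqI[OF assms *(2)]
      map_poly_of_int_hom power_add)
qed

lemma laurent_eval_add:
  assumes "z \<noteq> 0" shows "laurent_eval z (x + y) = laurent_eval z x + laurent_eval z y"
proof -
  obtain n p m p' where *: "qpow (int n) * x = laurent_of_poly p" "qpow (int m) * y = laurent_of_poly p'"
    using laurent_eq_shifted_poly by metis
  have "qpow (int (n + m)) * (x + y) = laurent_of_poly (monom 1 m * p + monom 1 n * p')"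
    by (simp add: algebra_simps laurent_of_poly_monom flip: * qpow_mult)
  from laurent_eval_eqI[OF assms this] show ?thesis using assms
    by (simp add: laurent_eval_eqI[OF assms *(1)] laurent_eval_eqI[OF assms *(2)]
      map_poly_of_int_hom power_add map_poly_monom poly_monom field_simps)
qed

lemma laurent_eval_1: "z \<noteq> 0 \<Longrightarrow> laurent_eval z 1 = 1"
  using laurent_eval_of_poly[of z 1] by simp

lemma laurent_eval_0: "z \<noteq> 0 \<Longrightarrow> laurent_eval z 0 = 0"
  using laurent_eval_of_poly[of z 0] by simp

lemma laurent_eval_uminus:
  assumes "z \<noteq> 0" shows "laurent_eval z (- x) = - laurent_eval z x"
  using laurent_eval_add[OF assms, of x "- x"] laurent_eval_0[OF assms] by (simp add: eq_neg_iff_add_eq_0 add.commute)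

lemma laurent_eval_qpow_1: "z \<noteq> 0 \<Longrightarrow> laurent_eval z (qpow 1) = z"
  using laurent_eval_of_poly[of z "monom 1 1"] by (simp add: laurent_of_poly_monom map_poly_monom poly_monom)

lemmas laurent_eval_simps = laurent_eval_mult laurent_eval_add laurent_eval_1 laurent_eval_0
  laurent_eval_uminus laurent_eval_qpow_1

section \<open>Divisibility by a cyclotomic polynomial as vanishing at the primitive roots\<close>

lemma lead_coeff_cyclotomic:
  assumes "d > 0" shows "lead_coeff (cyclotomic d) = 1"
proof -
  have "degree (map_poly of_int (cyclotomic d) :: complex poly) = degree (cyclotomic d)"
    by (rule degree_map_poly) simp
  moreover have "lead_coeff (map_poly of_int (cyclotomic d) :: complex poly) = 1"
    by (simp add: map_poly_cyclotomic[OF assms] lead_coeff_prod)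
  ultimately show ?thesis by (simp add: coeff_map_poly)
qed

lemma finite_primitive_roots_unity:
  assumes "d > 0" shows "finite (primitive_roots_unity d)"
proof (rule finite_subset)
  show "primitive_roots_unity d \<subseteq> {z. z ^ d = 1}" by (auto simp: primitive_roots_unity_def)
qed (use assms in \<open>simp add: finite_roots_unity\<close>)

lemma prod_linear_dvd:
  fixes p :: "complex poly"
  assumes "finite Z" "\<forall>z\<in>Z. poly p z = 0"
  shows "(\<Prod>z\<in>Z. [:- z, 1:]) dvd p"
  using assms
proof (induction Z arbitrary: p rule: finite_induct)
  case (insert w Z)
  then obtain r where r: "p = [:- w, 1:] * r" by (metis dvdE insertI1 poly_eq_0_iff_dvd)
  have "\<forall>z\<in>Z. poly r z = 0"
  proof
    fix z assume "z \<in> Z"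
    then have "poly p z = 0" "z \<noteq> w" using insert by auto
    then show "poly r z = 0" by (simp add: r)
  qed
  then have "(\<Prod>z\<in>Z. [:- z, 1:]) dvd r" by (rule insert.IH)
  then show ?case unfolding r prod.insert[OF insert.hyps(1,2)] by (rule mult_dvd_mono[OF dvd_refl])
qed simp

text \<open>Division by the monic polynomial \<Phi>_d stays within the integers. Over the complex
  numbers \<Phi>_d is a product of distinct linear factors and divides \<open>p\<close>, hence also
  the remainder, which then vanishes for reasons of degree.\<close>

lemma cyclotomic_dvd_poly:
  assumes "d > 0" "\<forall>z\<in>primitive_roots_unity d. poly (map_poly of_int p) z = 0"
  shows "cyclotomic d dvd p"
proof -
  let ?C = "map_poly of_int :: int poly \<Rightarrow> complex poly"
  let ?Q = "cyclotomic d"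
  have nz: "?Q \<noteq> 0" using lead_coeff_cyclotomic[OF assms(1)] by auto
  obtain a r where ar: "pseudo_divmod p ?Q = (a, r)" by fastforce
  have eq: "p = ?Q * a + r" and r: "r = 0 \<or> degree r < degree ?Q"
    using pseudo_divmod[OF nz ar] lead_coeff_cyclotomic[OF assms(1)] by simp_all
  have deg: "degree (?C p) = degree p" for p :: "int poly"
    by (rule degree_map_poly) simp
  have "?C ?Q dvd ?C p"
    unfolding map_poly_cyclotomic[OF assms(1)]
    using prod_linear_dvd[OF finite_primitive_roots_unity] assms by blast
  then have "?C ?Q dvd ?C r"
    unfolding eq map_poly_of_int_hom by (metis dvd_add_right_iff dvd_triv_left)
  have "r = 0"
  proof (rule ccontr)
    assume "r \<noteq> 0"
    then have "?C r \<noteq> 0" using map_poly_of_int_inj[of r 0] by auto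
    then have "degree (?C ?Q) \<le> degree (?C r)" using \<open>?C ?Q dvd ?C r\<close> by (rule dvd_imp_degree_le[rotated])
    then show False using r \<open>r \<noteq> 0\<close> by (simp add: deg)
  qed
  then show ?thesis using eq by simp
qed

lemma primitive_root_nonzero: "d > 0 \<Longrightarrow> z \<in> primitive_roots_unity d \<Longrightarrow> z \<noteq> 0"
  by (auto simp: primitive_roots_unity_def power_0_left)

text \<open>Powers of q are units, so divisibility of a Laurent polynomial reduces to that of a
  shifted ordinary polynomial.\<close>

lemma cyclotomic_dvd_iff:
  assumes "d > 0"
  shows "laurent_of_poly (cyclotomic d) dvd x \<longleftrightarrow> (\<forall>z\<in>primitive_roots_unity d. laurent_eval z x = 0)"
proof
  assume "laurent_of_poly (cyclotomic d) dvd x"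
  then obtain y where y: "x = laurent_of_poly (cyclotomic d) * y" by (elim dvdE)
  show "\<forall>z\<in>primitive_roots_unity d. laurent_eval z x = 0"
  proof
    fix z assume z: "z \<in> primitive_roots_unity d"
    then have "poly (map_poly of_int (cyclotomic d)) z = 0"
      using finite_primitive_roots_unity[OF assms]
      by (auto simp: map_poly_cyclotomic[OF assms] poly_prod)
    then show "laurent_eval z x = 0"
      using primitive_root_nonzero[OF assms z] by (simp add: y laurent_eval_mult laurent_eval_of_poly)
  qed
next
  assume *: "\<forall>z\<in>primitive_roots_unity d. laurent_eval z x = 0"
  obtain n p where p: "qpow (int n) * x = laurent_of_poly p" using laurent_eq_shifted_poly by blast
  have "\<forall>z\<in>primitive_roots_unity d. poly (map_poly of_int p) z = 0"
    using * laurent_eval_eqI[OF _ p] primitive_root_nonzero[OF assms] by fastforce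
  then obtain t where t: "p = cyclotomic d * t" using cyclotomic_dvd_poly[OF assms] by (metis dvdE)
  have "x = qpow (- int n) * (qpow (int n) * x)" by (simp add: qpow_mult flip: mult.assoc)
  also have "\<dots> = laurent_of_poly (cyclotomic d) * (qpow (- int n) * laurent_of_poly t)"
    unfolding p t by (simp add: ac_simps)
  finally show "laurent_of_poly (cyclotomic d) dvd x" by (metis dvd_triv_left)
qed

text \<open>Serves twice: it shows that primitive roots exist, and it is the root whose real part is
  large enough when d is at least 6.\<close>

lemma cis_in_primitive_roots_unity:
  assumes "d > 0" shows "cis (2 * pi / real d) \<in> primitive_roots_unity d"
proof -
  have "cis (2 * pi / real d) ^ k \<noteq> 1" if "0 < k" "k < d" for k
  proof
    assume "cis (2 * pi / real d) ^ k = 1"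
    then have "cis (real k * (2 * pi / real d)) = 1" by (simp only: Complex.DeMoivre)
    then have "Re (cis (real k * (2 * pi / real d))) = 1" by (simp only: one_complex.sel)
    then have "cos (real k * (2 * pi / real d)) = 1" by (simp only: cis.sel)
    then obtain j :: int where j: "real k * (2 * pi / real d) = of_int j * 2 * pi"
      unfolding cos_one_2pi_int by blast
    then have "(2 * pi) * (real k / real d) = (2 * pi) * of_int j" by (simp add: ac_simps)
    then have "real k / real d = of_int j" by (simp only: mult_cancel_left) simp
    moreover have "0 < real k / real d" "real k / real d < 1" using that by auto
    ultimately show False by (metis of_int_0_less_iff of_int_less_1_iff int_one_le_iff_zero_less not_le)
  qed
  moreover have "cis (2 * pi / real d) ^ d = 1" using assms by (simp add: Complex.DeMoivre)
  ultimately show ?thesis by (auto simp: primitive_roots_unity_def)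
qed

subsection \<open>The action of \<open>S\<close> on deformed rationals\<close>

abbreviation q_fract :: "laurent fract" where "q_fract \<equiv> Fraction_Field.Fract (qpow 1) 1"

text \<open>The expansion of 2 - 1/\<alpha> is that of \<alpha> with a 2 put in front. Computing its
  deformation once from the matrix and once by shifting -1/\<alpha> twice gives the
  identity.\<close>

lemma qrat_reciprocal_gt_1:
  assumes "\<alpha> > 1" shows "q_fract * qrat \<alpha> * qrat (- 1 / \<alpha>) = - 1"
proof -
  obtain cs where cs: "hj_expansion \<alpha> = cs" "is_hj cs" "hj_val cs = \<alpha>"
    using hj_expansion[OF assms] by blast
  then have hj: "hj_expansion (- 1 / \<alpha> + 1 + 1) = 2 # cs"
    by (intro hj_expansion_eqI) (auto simp: is_hj_def neq_Nil_conv)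
  define a b where "a = M_q cs $ 1 $ 1" and "b = M_q cs $ 2 $ 1"
  have a: "a \<noteq> 0" unfolding a_def
    using M_q_column_poly[of cs] cs(2) laurent_of_poly_nonzero by (auto simp: is_hj_def)
  have b: "b \<noteq> 0" unfolding b_def
    using M_q_column_poly[of cs] cs(2) laurent_of_poly_nonzero by (auto simp: is_hj_def)
  have qa: "qrat \<alpha> = Fraction_Field.Fract a b" using qrat_gt_1[OF assms] cs by (simp add: a_def b_def)
  have "- 1 / \<alpha> + 1 + 1 > 1" using assms by (simp add: field_simps)
  have alg: "Q * (Q * x) = Q * (- y)" if "Q * (Q * x + 1) + 1 = 1 + Q - Q * y" for Q x y :: "laurent fract"
    using that by (simp add: algebra_simps eq_neg_iff_add_eq_0)
  from qrat_gt_1[OF \<open>- 1 / \<alpha> + 1 + 1 > 1\<close>]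
  have "q_fract * (q_fract * qrat (- 1 / \<alpha>) + 1) + 1
      = Fraction_Field.Fract ((1 + qpow 1) * a - qpow 1 * b) a"
    unfolding hj qrat_add_1 by (simp add: M_q_Cons a_def b_def numeral_2_eq_2)
  also have "\<dots> = 1 + q_fract - q_fract * Fraction_Field.Fract b a"
    using a by (simp add: One_fract_def eq_fract algebra_simps)
  finally have "q_fract * (q_fract * qrat (- 1 / \<alpha>)) = q_fract * (- Fraction_Field.Fract b a)"
    by (rule alg)
  then have *: "q_fract * qrat (- 1 / \<alpha>) = - Fraction_Field.Fract b a"
    by (simp only: mult_cancel_left q_fract_nonzero) simp
  have "q_fract * qrat \<alpha> * qrat (- 1 / \<alpha>) = qrat \<alpha> * (q_fract * qrat (- 1 / \<alpha>))"
    by (simp only: ac_simps)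
  also have "\<dots> = - 1" unfolding * qa using a b by (simp add: One_fract_def eq_fract)
  finally show ?thesis .
qed

text \<open>This is the relation RSRSR = S of the modular group in deformed form: the hypotheses are
  the two inner applications of S, the conclusion is the outer one.\<close>

lemma reciprocal_transfer:
  fixes Q a b c g n :: "'a :: field"
  assumes "Q \<noteq> 0" "Q * (Q * g + 1) * b = - 1" "Q * g * (Q * n + 1) = - 1"
  shows "Q * (Q * b + 1) * n = - 1"
proof -
  have g: "Q * g + 1 \<noteq> 0" "g \<noteq> 0" using assms by auto
  have b: "Q * b = - 1 / (Q * g + 1)" using assms(2) g by (simp add: field_simps)
  have n: "Q * n = - 1 / (Q * g) - 1" using assms(3,1) g by (simp add: field_simps)
  have "Q * (Q * b + 1) * n = (Q * b + 1) * (Q * n)" by (simp add: algebra_simps)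
  also have "\<dots> = (Q * g / (Q * g + 1)) * (- (Q * g + 1) / (Q * g))"
    unfolding b n using g assms(1) by (simp add: divide_simps)
  also have "\<dots> = - 1" using g assms(1) by (simp add: divide_simps)
  finally show ?thesis .
qed

text \<open>Subtractive Euclidean algorithm: a fraction p/m below 1 is reduced to p/(m - p), until
  it is at least 1.\<close>

lemma qrat_reciprocal_pos:
  fixes p m :: int
  assumes "p > 0" "m > 0"
  shows "q_fract * qrat (of_int p / of_int m) * qrat (- 1 / (of_int p / of_int m)) = - 1"
  using assms
proof (induction "nat m" arbitrary: p m rule: less_induct)
  case less
  consider "p > m" | "p = m" | "p < m" by linarith
  then show ?case
  proof cases
    case 1
    then show ?thesis using less.prems by (intro qrat_reciprocal_gt_1) (simp add: field_simps)
  next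
    case 2
    have "qrat 1 = 1" using qrat_add_1[of 0] by (simp add: qrat_0)
    moreover have "q_fract * qrat (- 1) = - 1" 
      using qrat_add_1[of "- 1"] by (simp add: qrat_0 eq_neg_iff_add_eq_0)
    ultimately show ?thesis using 2 less.prems by simp
  next
    case 3
    \<comment> \<open>Here \<gamma> = \<alpha>/(1 - \<alpha>) has the smaller denominator m - p, so
      induction applies to it, while \<gamma> + 1 exceeds 1 and is covered by the matrix
      computation.\<close>
    define \<alpha> \<gamma> :: rat where "\<alpha> = of_int p / of_int m" and "\<gamma> = of_int p / of_int (m - p)"
    have eqs: "- 1 / (\<gamma> + 1) = \<alpha> - 1" "- 1 / \<gamma> = - 1 / \<alpha> + 1"
      using less.prems 3 by (simp_all add: \<alpha>_def \<gamma>_def field_simps)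
    have "\<gamma> > 0" using less.prems 3 by (simp add: \<gamma>_def)
    then have "q_fract * qrat (\<gamma> + 1) * qrat (\<alpha> - 1) = - 1"
      using qrat_reciprocal_gt_1[of "\<gamma> + 1"] unfolding eqs(1) by simp
    moreover have "q_fract * qrat \<gamma> * qrat (- 1 / \<gamma>) = - 1"
      unfolding \<gamma>_def using less.prems 3 by (intro less.hyps) auto
    moreover have "qrat \<alpha> = q_fract * qrat (\<alpha> - 1) + 1" using qrat_add_1[of "\<alpha> - 1"] by simp
    ultimately show ?thesis
      using reciprocal_transfer[OF q_fract_nonzero, of "qrat \<gamma>" "qrat (\<alpha> - 1)" "qrat (- 1 / \<alpha>)"]
      unfolding eqs(2) qrat_add_1 \<alpha>_def[symmetric] by simp
  qed
qed

lemma qrat_reciprocal: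
  assumes "\<alpha> \<noteq> 0" shows "q_fract * qrat \<alpha> * qrat (- 1 / \<alpha>) = - 1"
proof -
  have pos: "q_fract * qrat \<beta> * qrat (- 1 / \<beta>) = - 1" if "\<beta> > 0" for \<beta>
  proof -
    obtain r s where rs: "\<beta> = Rat.Fract r s" "s > 0" by (cases \<beta>) auto
    then have b: "\<beta> = of_int r / of_int s" by (simp add: Fract_of_int_quotient)
    then have "r > 0" using that rs(2) by (simp add: zero_less_divide_iff)
    then show ?thesis unfolding b using rs(2) by (rule qrat_reciprocal_pos)
  qed
  show ?thesis
  proof (cases "\<alpha> > 0")
    case False
    \<comment> \<open>The identity is symmetric under exchanging \<alpha> and -1/\<alpha>, exactly
      one of which is positive.\<close>
    then have "- 1 / \<alpha> > 0" using assms by (simp add: field_simps)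
    from pos[OF this] show ?thesis using assms by (simp add: ac_simps)
  qed (rule pos)
qed

subsection \<open>Specialized fractions as points of the projective line\<close>

text \<open>The type \<^typ>\<open>complex option\<close> stands for the projective line, \<^const>\<open>None\<close> being infinity.\<close>

definition proj_point :: "complex \<Rightarrow> complex \<Rightarrow> complex option" where
  "proj_point a b = (if b = 0 then None else Some (a / b))"

fun move_R :: "complex \<Rightarrow> complex option \<Rightarrow> complex option" where
  "move_R z None = None"
| "move_R z (Some w) = Some (z * w + 1)"

fun move_S :: "complex \<Rightarrow> complex option \<Rightarrow> complex option" where
  "move_S z None = Some 0"
| "move_S z (Some w) = (if w = 0 then None else Some (- 1 / (z * w)))"

text \<open>Infinity needs its own branch: division by zero in the rationals gives 0, so the second
  branch would produce the point of 0. The pair (0, 0) also gets infinity as a default.\<close>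

definition qrat_point :: "complex \<Rightarrow> int \<Rightarrow> int \<Rightarrow> complex option" where
  "qrat_point z r s = (if s = 0 then None else
     proj_point (laurent_eval z (qnum (of_int r / of_int s))) (laurent_eval z (qden (of_int r / of_int s))))"

lemma qrat_Fract: "qrat \<alpha> = Fraction_Field.Fract (qnum \<alpha>) (qden \<alpha>)"
  using is_qrat_pair_qnum_qden[of \<alpha>] by (simp add: is_qrat_pair_def)

lemma qden_nonzero: "qden \<alpha> \<noteq> 0"
  using is_qrat_pair_qnum_qden[of \<alpha>] laurent_of_poly_nonzero by (auto simp: is_qrat_pair_def)

text \<open>The Bezout identity between numerator and denominator survives evaluation, so the two
  values are homogeneous coordinates of a point.\<close>

lemma laurent_eval_nonzero:
  assumes "z \<noteq> 0" shows "laurent_eval z (qnum \<alpha>) \<noteq> 0 \<or> laurent_eval z (qden \<alpha>) \<noteq> 0"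
proof -
  obtain a b where ab: "is_qrat_pair \<alpha> a b" "bezout_laurent a b" using is_qrat_pair_exists by blast
  then obtain x y where "x * qnum \<alpha> + y * qden \<alpha> = 1"
    unfolding bezout_laurent_def qnum_qden_eqI[OF ab(1)] by blast
  from arg_cong[OF this, of "laurent_eval z"] show ?thesis
    using assms by (auto simp: laurent_eval_simps)
qed

lemma proj_point_eqI:
  assumes "a * d = c * b" "a \<noteq> 0 \<or> b \<noteq> 0" "c \<noteq> 0 \<or> d \<noteq> 0"
  shows "proj_point a b = proj_point c d"
  using assms by (auto simp: proj_point_def field_simps)

text \<open>The identity of fractions is cross-multiplied before evaluating, so that it still
  determines the point when a denominator vanishes at \<open>z\<close>.\<close>

lemma qrat_point_R:
  assumes "z \<noteq> 0" shows "qrat_point z (r + s) s = move_R z (qrat_point z r s)"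
proof (cases "s = 0")
  case False
  define \<alpha> :: rat where "\<alpha> = of_int r / of_int s"
  have \<alpha>1: "of_int (r + s) / of_int s = \<alpha> + 1" using False by (simp add: \<alpha>_def field_simps)
  have "Fraction_Field.Fract (qnum (\<alpha> + 1)) (qden (\<alpha> + 1))
    = Fraction_Field.Fract (qpow 1 * qnum \<alpha> + qden \<alpha>) (qden \<alpha>)"
    using qrat_add_1[of \<alpha>] qden_nonzero by (simp add: qrat_Fract One_fract_def)
  then have "qnum (\<alpha> + 1) * qden \<alpha> = (qpow 1 * qnum \<alpha> + qden \<alpha>) * qden (\<alpha> + 1)"
    using qden_nonzero by (simp add: eq_fract)
  from arg_cong[OF this, of "laurent_eval z"]
  have "proj_point (laurent_eval z (qnum (\<alpha> + 1))) (laurent_eval z (qden (\<alpha> + 1)))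
     = proj_point (z * laurent_eval z (qnum \<alpha>) + laurent_eval z (qden \<alpha>)) (laurent_eval z (qden \<alpha>))"
    using laurent_eval_nonzero[OF assms, of \<alpha>] laurent_eval_nonzero[OF assms, of "\<alpha> + 1"] assms
    by (intro proj_point_eqI) (auto simp: laurent_eval_simps)
  moreover have "qrat_point z (r + s) s
      = proj_point (laurent_eval z (qnum (\<alpha> + 1))) (laurent_eval z (qden (\<alpha> + 1)))"
    "qrat_point z r s = proj_point (laurent_eval z (qnum \<alpha>)) (laurent_eval z (qden \<alpha>))"
    using False unfolding qrat_point_def \<alpha>1 by (simp_all flip: \<alpha>_def)
  ultimately show ?thesis by (simp add: proj_point_def add_divide_distrib)
qed (simp add: qrat_point_def)

lemma qrat_point_infinity: "qrat_point z r 0 = None"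
  by (simp add: qrat_point_def)

lemma qrat_point_zero: "z \<noteq> 0 \<Longrightarrow> s \<noteq> 0 \<Longrightarrow> qrat_point z 0 s = Some 0"
proof -
  assume *: "z \<noteq> 0" "s \<noteq> 0"
  have "Fraction_Field.Fract (qnum 0) (qden 0) = 0" using qrat_0 by (simp add: qrat_Fract)
  then have "qnum 0 = 0" using qden_nonzero by (simp add: Zero_fract_def eq_fract)
  then show ?thesis using * laurent_eval_nonzero[of z 0]
    by (simp add: qrat_point_def proj_point_def laurent_eval_0)
qed

text \<open>The cross-multiplied reciprocal identity is evaluated as for \<open>R\<close>; when r or
  s is 0, the move exchanges 0 and infinity. The pair (0, 0) is excluded because its default point
  infinity would have to move.\<close>

lemma qrat_point_S:
  assumes "z \<noteq> 0" "r \<noteq> 0 \<or> s \<noteq> 0"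
  shows "qrat_point z (- s) r = move_S z (qrat_point z r s)"
proof (cases "r = 0 \<or> s = 0")
  case True
  then show ?thesis using assms by (auto simp: qrat_point_infinity qrat_point_zero)
next
  case False
  define \<alpha> \<beta> :: rat where "\<alpha> = of_int r / of_int s" and "\<beta> = - 1 / \<alpha>"
  have \<beta>: "of_int (- s) / of_int r = \<beta>" using False by (simp add: \<alpha>_def \<beta>_def)
  have "\<alpha> \<noteq> 0" using False by (simp add: \<alpha>_def)
  from qrat_reciprocal[OF this]
  have "Fraction_Field.Fract (qpow 1 * qnum \<alpha> * qnum \<beta>) (qden \<alpha> * qden \<beta>) = Fraction_Field.Fract (- 1) 1"
    by (simp add: qrat_Fract One_fract_def \<beta>_def)
  then have "qpow 1 * qnum \<alpha> * qnum \<beta> = - (qden \<alpha> * qden \<beta>)"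
    using qden_nonzero by (simp add: eq_fract)
  from arg_cong[OF this, of "laurent_eval z"]
  have "proj_point (laurent_eval z (qnum \<beta>)) (laurent_eval z (qden \<beta>))
     = proj_point (- laurent_eval z (qden \<alpha>)) (z * laurent_eval z (qnum \<alpha>))"
    using laurent_eval_nonzero[OF assms(1), of \<alpha>] laurent_eval_nonzero[OF assms(1), of \<beta>] assms(1)
    by (intro proj_point_eqI) (auto simp: laurent_eval_simps ac_simps)
  moreover have "qrat_point z (- s) r
      = proj_point (laurent_eval z (qnum \<beta>)) (laurent_eval z (qden \<beta>))"
    "qrat_point z r s = proj_point (laurent_eval z (qnum \<alpha>)) (laurent_eval z (qden \<alpha>))"
    using False unfolding qrat_point_def \<beta> by (simp_all flip: \<alpha>_def)
  ultimately show ?thesis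
    using assms(1) laurent_eval_nonzero[OF assms(1), of \<alpha>] by (auto simp: proj_point_def)
qed

lemma qrat_point_minus: "qrat_point z (- r) (- s) = qrat_point z r s"
  by (simp add: qrat_point_def)

lemma qrat_point_eq_None_iff:
  "s \<noteq> 0 \<Longrightarrow> qrat_point z r s = None \<longleftrightarrow> laurent_eval z (qden (of_int r / of_int s)) = 0"
  by (simp add: qrat_point_def proj_point_def)

lemma qrat_point_eq_zero_iff:
  "z \<noteq> 0 \<Longrightarrow> s \<noteq> 0 \<Longrightarrow> qrat_point z r s = Some 0 \<longleftrightarrow> laurent_eval z (qnum (of_int r / of_int s)) = 0"
  using laurent_eval_nonzero[of z "of_int r / of_int s"] by (auto simp: qrat_point_def proj_point_def)

section \<open>Generation of all fractions from infinity by R and S\<close>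

text \<open>Euclidean algorithm: the moves R and S reach every coprime pair from (1, 0). Twice S
  changes the sign of a pair, which also yields the inverse of R.\<close>

lemma coprime_pair_induct [consumes 1, case_names infinity R S]:
  fixes r s :: int
  assumes "coprime r s"
    and infinity: "P 1 0"
    and R: "\<And>r s. coprime r s \<Longrightarrow> P r s \<Longrightarrow> P (r + s) s"
    and S: "\<And>r s. coprime r s \<Longrightarrow> P r s \<Longrightarrow> P (- s) r"
  shows "P r s"
proof -
  define Q where "Q r s \<longleftrightarrow> coprime r s \<and> P r s" for r s
  have QS: "Q r s \<Longrightarrow> Q (- s) r" for r s using S by (simp add: Q_def coprime_commute)
  have QR: "Q r s \<Longrightarrow> Q (r + s) s" for r s
    using R by (simp add: Q_def) (metis coprime_iff_gcd_eq_1 gcd_add1)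
  have neg: "Q r s \<Longrightarrow> Q (- r) (- s)" for r s using QS[OF QS] by simp
  \<comment> \<open>The inverse of \<open>R\<close> is \<open>SRSRS\<close> up to sign.\<close>
  have QR': "Q (r - s) s" if "Q r s" for r s
    using neg[OF QS[OF QR[OF QS[OF QR[OF QS[OF that]]]]]] by simp
  have QRk: "Q (r + k * s) s" if "Q r s" for r s k
  proof (induction k rule: int_induct[of _ 0])
    case base
    show ?case using that by simp
  next
    case (step1 i)
    show ?case using QR[OF step1(2)] by (simp add: algebra_simps)
  next
    case (step2 i)
    show ?case using QR'[OF step2(2)] by (simp add: algebra_simps)
  qed
  have "Q r s" using assms(1)
  proof (induction "nat \<bar>s\<bar>" arbitrary: r s rule: less_induct)
    case less
    have Q1: "Q 1 0" using infinity by (simp add: Q_def)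
    show ?case
    proof (cases "s = 0")
      case True
      then have "r = 1 \<or> r = - 1" using less.prems by auto
      then show ?thesis using Q1 neg[OF Q1] True by auto
    next
      case False
      \<comment> \<open>The pair (r, s) arises from (s, -(r mod s)) by one S followed by the power
        \<open>r div s\<close> of R.\<close>
      have "coprime s (- (r mod s))" using less.prems by (simp add: coprime_iff_gcd_eq_1 gcd_red_int[of r s, symmetric])
      moreover have "\<bar>r mod s\<bar> < \<bar>s\<bar>" using False by (rule abs_mod_less)
      ultimately have "Q s (- (r mod s))" by (intro less.hyps) simp_all
      from QRk[OF QS[OF this], of "r div s"] show ?thesis by simp
    qed
  qed
  then show ?thesis by (simp add: Q_def)
qed

text \<open>
  Since the points move along with \<open>R\<close> and \<open>S\<close>, a table of points on residue classes that is
  closed under these two moves computes all of them.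
\<close>

lemma qrat_point_in_table:
  fixes d :: int
  assumes "coprime r s" "z \<noteq> 0" "(1 mod d, 0, None) \<in> T"
    and closed: "\<forall>(a, b, w)\<in>T. ((a + b) mod d, b, move_R z w) \<in> T \<and> ((- b) mod d, a, move_S z w) \<in> T"
  shows "(r mod d, s mod d, qrat_point z r s) \<in> T"
  using assms(1)
proof (induction rule: coprime_pair_induct)
  case infinity
  show ?case using assms(3) by (simp add: qrat_point_infinity)
next
  case (R r s)
  then have "((r mod d + s mod d) mod d, s mod d, move_R z (qrat_point z r s)) \<in> T" using closed by blast
  then show ?case by (simp add: qrat_point_R[OF assms(2)] mod_add_eq)
next
  case (S r s)
  then have "((- (s mod d)) mod d, r mod d, move_S z (qrat_point z r s)) \<in> T" using closed by blast
  moreover have "r \<noteq> 0 \<or> s \<noteq> 0" using S by auto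
  ultimately show ?case by (simp add: qrat_point_S[OF assms(2)] mod_minus_eq)
qed

subsection \<open>The finite orbits\<close>

text \<open>Clears the division, so that each table entry becomes a polynomial identity modulo the
  equation of \<open>z\<close>.\<close>

lemma move_S_eqI:
  assumes "z * w * w' = - 1" shows "move_S z (Some w) = Some w'"
proof -
  have "w \<noteq> 0" "z \<noteq> 0" using assms by auto
  moreover have "- 1 = w' * (z * w)" by (simp add: ac_simps flip: assms)
  ultimately show ?thesis by (simp add: nonzero_divide_eq_eq del: mult_minus_left mult_minus_right)
qed

lemma move_R_eqI: "z * w + 1 = w' \<Longrightarrow> move_R z (Some w) = Some w'"
  by simp

text \<open>Gives the nonvanishing of table entries for free: a point that S sends to a finite point
  is not 0.\<close>

lemma move_S_Some_imp_nonzero: "move_S z (Some w) = Some w' \<Longrightarrow> w \<noteq> 0"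
  by auto

text \<open>With z = -1 the orbit is the triangle infinity, 0, 1, one vertex for each residue
  pair.\<close>

lemma qrat_point_mod_2:
  assumes "z \<in> primitive_roots_unity 2" "coprime r s"
  shows "qrat_point z r s = None \<longleftrightarrow> s mod 2 = 0" "qrat_point z r s = Some 0 \<longleftrightarrow> r mod 2 = 0"
    "s mod 2 = 0 \<Longrightarrow> r mod 2 = 1" "r mod 2 = 0 \<Longrightarrow> s mod 2 = 1"
proof -
  have z: "z = - 1"
    using assms(1) power_one_right[of z] by (auto simp: primitive_roots_unity_def power2_eq_1_iff simp del: power_one_right)
  have "move_S z (Some 1) = Some 1" "move_R z (Some 1) = Some 0" by (simp_all add: z)
  then have "(r mod 2, s mod 2, qrat_point z r s) \<in> {(1, 0, None), (0, 1, Some 0), (1, 1, Some 1)}"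
    using assms(2) z by (intro qrat_point_in_table) auto
  then show "qrat_point z r s = None \<longleftrightarrow> s mod 2 = 0" "qrat_point z r s = Some 0 \<longleftrightarrow> r mod 2 = 0"
    "s mod 2 = 0 \<Longrightarrow> r mod 2 = 1" "r mod 2 = 0 \<Longrightarrow> s mod 2 = 1"
    by auto
qed

text \<open>The four vertices of the tetrahedron are infinity, 0, 1 and \<open>x\<close>, the value
  of 2/1; each belongs to a residue pair and its negative. The restrictions on residues hold because
  no other pair with a zero entry is in the table.\<close>

lemma qrat_point_mod_3:
  assumes "z \<in> primitive_roots_unity 3" "coprime r s"
  shows "qrat_point z r s = None \<longleftrightarrow> s mod 3 = 0" "qrat_point z r s = Some 0 \<longleftrightarrow> r mod 3 = 0"
    "s mod 3 = 0 \<Longrightarrow> r mod 3 = 1 \<or> r mod 3 = 2" "r mod 3 = 0 \<Longrightarrow> s mod 3 = 1 \<or> s mod 3 = 2"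
proof -
  have "z ^ 3 = 1" "z ^ 1 \<noteq> 1" using assms(1) unfolding primitive_roots_unity_def by auto
  then have "(z - 1) * (1 + z + z ^ 2) = 0" "z \<noteq> 1" "z \<noteq> 0"
    by (auto simp: algebra_simps power2_eq_square power3_eq_cube)
  then have z: "1 + z + z ^ 2 = 0" "z \<noteq> 0" by auto
  define x where "x = 1 + z"
  have S: "move_S z (Some 1) = Some x" "move_S z (Some x) = Some 1"
    using z(1) unfolding x_def by (intro move_S_eqI; algebra)+
  have R: "move_R z (Some 1) = Some x" "move_R z (Some x) = Some 0"
    using z(1) unfolding x_def by (intro move_R_eqI; (simp add: algebra_simps numeral_eq_Suc; fail | algebra))+
  define T :: "(int \<times> int \<times> complex option) set" where "T = {(1, 0, None), (2, 0, None), (0, 1, Some 0),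
    (0, 2, Some 0), (1, 1, Some 1), (2, 2, Some 1), (2, 1, Some x), (1, 2, Some x)}"
  have mem: "(r mod 3, s mod 3, qrat_point z r s) \<in> T"
    using assms(2) z(2) unfolding T_def
    by (rule qrat_point_in_table) (simp_all add: S R del: move_S.simps(2) move_R.simps(2), simp_all)
  have nz: "x \<noteq> 0" using S[THEN move_S_Some_imp_nonzero] by auto
  have "\<forall>(a, b, w)\<in>T. (w = None \<longleftrightarrow> b = 0) \<and> (w = Some 0 \<longleftrightarrow> a = 0)
      \<and> (b = 0 \<longrightarrow> a = 1 \<or> a = 2) \<and> (a = 0 \<longrightarrow> b = 1 \<or> b = 2)"
    using nz by (simp add: T_def)
  note * = bspec[OF this mem, unfolded prod.case]
  show "qrat_point z r s = None \<longleftrightarrow> s mod 3 = 0" "qrat_point z r s = Some 0 \<longleftrightarrow> r mod 3 = 0"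
    "s mod 3 = 0 \<Longrightarrow> r mod 3 = 1 \<or> r mod 3 = 2" "r mod 3 = 0 \<Longrightarrow> s mod 3 = 1 \<or> s mod 3 = 2"
    using * by argo+
qed

text \<open>Six points, the vertices of the octahedron: infinity, 0, 1, and the values
  \<open>x\<close>, \<open>z\<close>, \<open>c\<close> of 2/1, 3/1, 1/2.\<close>

lemma qrat_point_mod_4:
  assumes "z \<in> primitive_roots_unity 4" "coprime r s"
  shows "qrat_point z r s = None \<longleftrightarrow> s mod 4 = 0" "qrat_point z r s = Some 0 \<longleftrightarrow> r mod 4 = 0"
    "s mod 4 = 0 \<Longrightarrow> r mod 4 = 1 \<or> r mod 4 = 3" "r mod 4 = 0 \<Longrightarrow> s mod 4 = 1 \<or> s mod 4 = 3"
proof -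
  have "z ^ 4 = 1" "z ^ 2 \<noteq> 1" using assms(1) unfolding primitive_roots_unity_def by auto
  then have "(z ^ 2 - 1) * (z ^ 2 + 1) = 0" "z ^ 2 - 1 \<noteq> 0"
    by (auto simp: algebra_simps simp flip: power_add)
  then have "z ^ 2 + 1 = 0" by (simp only: mult_eq_0_iff) simp
  then have z: "z ^ 2 = - 1" "z \<noteq> 0" by (auto simp: eq_neg_iff_add_eq_0)
  \<comment> \<open>Since z^2 = -1, \<open>c\<close> is 1/(1 - z), the finite fixed point of
    \<open>move_R z\<close>: R takes the pair (1, 2) to (3, 2), its negative modulo 4.\<close>
  define x c where "x = 1 + z" and "c = (1 + z) / 2"
  have c: "2 * c = 1 + z" by (simp add: c_def)
  have S: "move_S z (Some 1) = Some z" "move_S z (Some z) = Some 1"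
    "move_S z (Some x) = Some c" "move_S z (Some c) = Some x"
    using z(1) c unfolding x_def by (intro move_S_eqI; algebra)+
  have R: "move_R z (Some 1) = Some x" "move_R z (Some x) = Some z" "move_R z (Some z) = Some 0"
    "move_R z (Some c) = Some c"
    using z(1) c unfolding x_def by (intro move_R_eqI; (simp add: algebra_simps numeral_eq_Suc; fail | algebra))+
  define T :: "(int \<times> int \<times> complex option) set" where "T = {(1, 0, None), (3, 0, None), (0, 1, Some 0),
    (0, 3, Some 0), (1, 1, Some 1), (3, 3, Some 1), (2, 1, Some x), (2, 3, Some x),
    (3, 1, Some z), (1, 3, Some z), (1, 2, Some c), (3, 2, Some c)}"
  have mem: "(r mod 4, s mod 4, qrat_point z r s) \<in> T"
    using assms(2) z(2) unfolding T_def
    by (rule qrat_point_in_table) (simp_all add: S R del: move_S.simps(2) move_R.simps(2), simp_all)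
  have nz: "x \<noteq> 0" "c \<noteq> 0" using S[THEN move_S_Some_imp_nonzero] by auto
  have "\<forall>(a, b, w)\<in>T. (w = None \<longleftrightarrow> b = 0) \<and> (w = Some 0 \<longleftrightarrow> a = 0)
      \<and> (b = 0 \<longrightarrow> a = 1 \<or> a = 3) \<and> (a = 0 \<longrightarrow> b = 1 \<or> b = 3)"
    using nz z(2) by (simp add: T_def)
  note * = bspec[OF this mem, unfolded prod.case]
  show "qrat_point z r s = None \<longleftrightarrow> s mod 4 = 0" "qrat_point z r s = Some 0 \<longleftrightarrow> r mod 4 = 0"
    "s mod 4 = 0 \<Longrightarrow> r mod 4 = 1 \<or> r mod 4 = 3" "r mod 4 = 0 \<Longrightarrow> s mod 4 = 1 \<or> s mod 4 = 3"
    using * by argo+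
qed

text \<open>Twelve points, the vertices of the icosahedron, each belonging to two opposite residue
  pairs. The condition on r cannot be dropped: the pairs (2, 0) and (3, 0) have the finite point
  \<open>c\<close> instead of infinity.\<close>

lemma qrat_point_mod_5:
  assumes "z \<in> primitive_roots_unity 5" "coprime r s"
  shows "qrat_point z r s = None \<longleftrightarrow> s mod 5 = 0 \<and> (r mod 5 = 1 \<or> r mod 5 = 4)"
    "qrat_point z r s = Some 0 \<longleftrightarrow> r mod 5 = 0 \<and> (s mod 5 = 1 \<or> s mod 5 = 4)"
proof -
  have "z ^ 5 = 1" "z ^ 1 \<noteq> 1" using assms(1) unfolding primitive_roots_unity_def by auto
  then have "(z - 1) * (1 + z + z ^ 2 + z ^ 3 + z ^ 4) = 0" "z \<noteq> 1" "z \<noteq> 0"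
    by (auto simp: algebra_simps numeral_eq_Suc)
  then have z: "1 + z + z ^ 2 + z ^ 3 + z ^ 4 = 0" "z \<noteq> 0" "1 - z \<noteq> 0" by auto
  \<comment> \<open>The finite fixed point of \<open>move_R z\<close>, as it must be, since R fixes
    the residue pair (2, 0).\<close>
  define c where "c = 1 / (1 - z)"
  have c: "(1 - z) * c = 1" using z(3) by (simp add: c_def)
  \<comment> \<open>\<open>x\<^sub>k\<close>, \<open>h\<^sub>k\<close> and \<open>c\<close> are the points of the residues \<open>(k, 1)\<close>, \<open>(k, 2)\<close> and \<open>(2, 0)\<close>.\<close>
  define x2 x3 x4 where "x2 = 1 + z" and "x3 = 1 + z + z ^ 2" and "x4 = - (z ^ 4)"
  define h0 h1 h2 h3 h4 where "h0 = 1 - z ^ 4" and "h1 = 1 + z + z ^ 3" and "h2 = z"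
    and "h3 = - (z ^ 3)" and "h4 = 1 + z ^ 2"
  note defs = x2_def x3_def x4_def h0_def h1_def h2_def h3_def h4_def
  have S: "move_S z (Some 1) = Some x4" "move_S z (Some x4) = Some 1"
    "move_S z (Some x2) = Some h4" "move_S z (Some h4) = Some x2"
    "move_S z (Some x3) = Some h1" "move_S z (Some h1) = Some x3"
    "move_S z (Some h2) = Some h3" "move_S z (Some h3) = Some h2"
    "move_S z (Some h0) = Some c" "move_S z (Some c) = Some h0"
    using z(1) c unfolding defs by (intro move_S_eqI; algebra)+
  have R: "move_R z (Some 1) = Some x2" "move_R z (Some x2) = Some x3" "move_R z (Some x3) = Some x4"
    "move_R z (Some x4) = Some 0" "move_R z (Some h0) = Some h2" "move_R z (Some h2) = Some h4"
    "move_R z (Some h4) = Some h1" "move_R z (Some h1) = Some h3" "move_R z (Some h3) = Some h0"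
    "move_R z (Some c) = Some c"
    using z(1) c unfolding defs by (intro move_R_eqI; (simp add: algebra_simps numeral_eq_Suc; fail | algebra))+
  define T :: "(int \<times> int \<times> complex option) set" where "T = {(1, 0, None), (4, 0, None), (0, 1, Some 0),
    (0, 4, Some 0), (1, 1, Some 1), (4, 4, Some 1), (2, 1, Some x2), (3, 4, Some x2),
    (3, 1, Some x3), (2, 4, Some x3), (4, 1, Some x4), (1, 4, Some x4), (2, 0, Some c), (3, 0, Some c),
    (0, 2, Some h0), (0, 3, Some h0), (1, 2, Some h1), (4, 3, Some h1), (2, 2, Some h2),
    (3, 3, Some h2), (3, 2, Some h3), (2, 3, Some h3), (4, 2, Some h4), (1, 3, Some h4)}"
  have mem: "(r mod 5, s mod 5, qrat_point z r s) \<in> T"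
    using assms(2) z(2) unfolding T_def
    by (rule qrat_point_in_table) (simp_all add: S R del: move_S.simps(2) move_R.simps(2), simp_all)
  have nz: "x2 \<noteq> 0" "x3 \<noteq> 0" "x4 \<noteq> 0" "h0 \<noteq> 0" "h1 \<noteq> 0" "h2 \<noteq> 0" "h3 \<noteq> 0" "h4 \<noteq> 0" "c \<noteq> 0"
    using S[THEN move_S_Some_imp_nonzero] by simp_all
  have "\<forall>(a, b, w)\<in>T. (w = None \<longleftrightarrow> b = 0 \<and> (a = 1 \<or> a = 4))
      \<and> (w = Some 0 \<longleftrightarrow> a = 0 \<and> (b = 1 \<or> b = 4))"
    using nz by (simp add: T_def)
  note * = bspec[OF this mem, unfolded prod.case]
  show "qrat_point z r s = None \<longleftrightarrow> s mod 5 = 0 \<and> (r mod 5 = 1 \<or> r mod 5 = 4)"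
    "qrat_point z r s = Some 0 \<longleftrightarrow> r mod 5 = 0 \<and> (s mod 5 = 1 \<or> s mod 5 = 4)"
    using * by argo+
qed

section \<open>Divisibility for d at most 5\<close>

text \<open>The criterion \<open>P\<close> does not depend on the root, so the quantifier over all
  primitive roots collapses, given that at least one exists.\<close>

lemma cyclotomic_dvd_qden_iff:
  assumes "d > 0" "s > 0" "\<And>z. z \<in> primitive_roots_unity d \<Longrightarrow> qrat_point z r s = None \<longleftrightarrow> P"
  shows "laurent_of_poly (cyclotomic d) dvd qden (of_int r / of_int s) \<longleftrightarrow> P"
  using assms cis_in_primitive_roots_unity[of d]
  by (auto simp: cyclotomic_dvd_iff qrat_point_eq_None_iff)

lemma cyclotomic_dvd_qnum_iff:
  assumes "d > 0" "s > 0" "\<And>z. z \<in> primitive_roots_unity d \<Longrightarrow> qrat_point z r s = Some 0 \<longleftrightarrow> P"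
  shows "laurent_of_poly (cyclotomic d) dvd qnum (of_int r / of_int s) \<longleftrightarrow> P"
  using assms cis_in_primitive_roots_unity[of d] primitive_root_nonzero[of d]
  by (auto simp: cyclotomic_dvd_iff qrat_point_eq_zero_iff)

lemma cyclotomic_dvd_small:
  fixes r s :: int
  assumes "d \<ge> 2" "d \<le> 5" "coprime r s" "s > 0"
  shows "laurent_of_poly (cyclotomic d) dvd qden (of_int r / of_int s)
      \<longleftrightarrow> [s = 0] (mod int d) \<and> ([r = 1] (mod int d) \<or> [r = - 1] (mod int d))" (is ?den)
    and "d \<le> 4 \<Longrightarrow> laurent_of_poly (cyclotomic d) dvd qden (of_int r / of_int s) \<longleftrightarrow> int d dvd s"
      (is "_ \<Longrightarrow> ?den4")
    and "laurent_of_poly (cyclotomic d) dvd qnum (of_int r / of_int s)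
      \<longleftrightarrow> [r = 0] (mod int d) \<and> ([s = 1] (mod int d) \<or> [s = - 1] (mod int d))" (is ?num)
    and "d \<le> 4 \<Longrightarrow> laurent_of_poly (cyclotomic d) dvd qnum (of_int r / of_int s) \<longleftrightarrow> int d dvd r"
      (is "_ \<Longrightarrow> ?num4")
proof -
  let ?z = "cis (2 * pi / real d)"
  \<comment> \<open>The restrictions on residues do not mention a root but were read off a table
    built from one; this root supplies it.\<close>
  have prim: "?z \<in> primitive_roots_unity d"
    using assms(1) by (intro cis_in_primitive_roots_unity) simp
  have mods: "[x = 0] (mod int d) \<longleftrightarrow> x mod int d = 0" "[x = 1] (mod int d) \<longleftrightarrow> x mod int d = 1"
    "[x = - 1] (mod int d) \<longleftrightarrow> x mod int d = int d - 1" "int d dvd x \<longleftrightarrow> x mod int d = 0" for x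
    using assms(1) by (simp_all add: cong_def zmod_minus1 dvd_eq_mod_eq_0)
  have coe: "int 2 = 2" "int 3 = 3" "int 4 = 4" "int 5 = 5" "(2::int) - 1 = 1" "(3::int) - 1 = 2"
    "(4::int) - 1 = 3" "(5::int) - 1 = 4"
    by simp_all
  consider "d = 2" | "d = 3" | "d = 4" | "d = 5" using assms(1,2) by linarith
  then have "?den \<and> (d \<le> 4 \<longrightarrow> ?den4) \<and> ?num \<and> (d \<le> 4 \<longrightarrow> ?num4)"
  proof cases
    case 1
    note p = qrat_point_mod_2[OF _ assms(3)]
    have "laurent_of_poly (cyclotomic 2) dvd qden (of_int r / of_int s) \<longleftrightarrow> s mod 2 = 0"
      by (rule cyclotomic_dvd_qden_iff[OF _ assms(4) p(1)]) simp_all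
    moreover have "laurent_of_poly (cyclotomic 2) dvd qnum (of_int r / of_int s) \<longleftrightarrow> r mod 2 = 0"
      by (rule cyclotomic_dvd_qnum_iff[OF _ assms(4) p(2)]) simp_all
    ultimately show ?thesis
      unfolding mods using p(3,4)[OF prim[unfolded 1]] unfolding 1 coe by argo
  next
    case 2
    note p = qrat_point_mod_3[OF _ assms(3)]
    have "laurent_of_poly (cyclotomic 3) dvd qden (of_int r / of_int s) \<longleftrightarrow> s mod 3 = 0"
      by (rule cyclotomic_dvd_qden_iff[OF _ assms(4) p(1)]) simp_all
    moreover have "laurent_of_poly (cyclotomic 3) dvd qnum (of_int r / of_int s) \<longleftrightarrow> r mod 3 = 0"
      by (rule cyclotomic_dvd_qnum_iff[OF _ assms(4) p(2)]) simp_all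
    ultimately show ?thesis
      unfolding mods using p(3,4)[OF prim[unfolded 2]] unfolding 2 coe by argo
  next
    case 3
    note p = qrat_point_mod_4[OF _ assms(3)]
    have "laurent_of_poly (cyclotomic 4) dvd qden (of_int r / of_int s) \<longleftrightarrow> s mod 4 = 0"
      by (rule cyclotomic_dvd_qden_iff[OF _ assms(4) p(1)]) simp_all
    moreover have "laurent_of_poly (cyclotomic 4) dvd qnum (of_int r / of_int s) \<longleftrightarrow> r mod 4 = 0"
      by (rule cyclotomic_dvd_qnum_iff[OF _ assms(4) p(2)]) simp_all
    ultimately show ?thesis
      unfolding mods using p(3,4)[OF prim[unfolded 3]] unfolding 3 coe by argo
  next
    case 4
    note p = qrat_point_mod_5[OF _ assms(3)]
    have "laurent_of_poly (cyclotomic 5) dvd qden (of_int r / of_int s) \<longleftrightarrow> s mod 5 = 0 \<and> (r mod 5 = 1 \<or> r mod 5 = 4)"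
      by (rule cyclotomic_dvd_qden_iff[OF _ assms(4) p(1)]) simp_all
    moreover have "laurent_of_poly (cyclotomic 5) dvd qnum (of_int r / of_int s) \<longleftrightarrow> r mod 5 = 0 \<and> (s mod 5 = 1 \<or> s mod 5 = 4)"
      by (rule cyclotomic_dvd_qnum_iff[OF _ assms(4) p(2)]) simp_all
    ultimately show ?thesis
      unfolding mods unfolding 4 coe by simp
  qed
  then show ?den ?num "d \<le> 4 \<Longrightarrow> ?den4" "d \<le> 4 \<Longrightarrow> ?num4" by blast+
qed

subsection \<open>Powers of \<open>R\<^sup>3 S\<close>\<close>

text \<open>The value at n is U_(n-1)(t/2), with U the Chebyshev polynomials of the second kind;
  these occur in powers of matrices of determinant 1 and trace t. The type is left general: integers
  with t = 3 give the fractions, real t their specialized values.\<close>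

fun chebyshev :: "'a :: comm_ring_1 \<Rightarrow> nat \<Rightarrow> 'a" where
  "chebyshev t 0 = 0"
| "chebyshev t (Suc 0) = 1"
| "chebyshev t (Suc (Suc n)) = t * chebyshev t (Suc n) - chebyshev t n"

text \<open>For t at least 2 the increments never decrease, and the first one is 1.\<close>

lemma chebyshev_growth:
  fixes t :: "'a :: linordered_idom"
  assumes "t \<ge> 2"
  shows "chebyshev t n \<ge> 0 \<and> chebyshev t (Suc n) \<ge> chebyshev t n + 1"
proof (induction n)
  case (Suc n)
  then have "2 * chebyshev t (Suc n) \<le> t * chebyshev t (Suc n)"
    using assms by (intro mult_right_mono) auto
  moreover have "chebyshev t (Suc (Suc n)) = t * chebyshev t (Suc n) - chebyshev t n" by simp
  ultimately show ?case using Suc by linarith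
qed simp

lemma chebyshev_pos:
  fixes t :: "'a :: linordered_idom"
  assumes "t \<ge> 2" "n > 0" shows "chebyshev t n > 0"
  using chebyshev_growth[OF assms(1), of "n - 1"] assms(2) by simp

lemma coprime_chebyshev: "coprime (chebyshev (t :: int) (Suc n)) (chebyshev t n)"
proof (induction n)
  case (Suc n)
  show ?case
  proof (rule coprimeI)
    fix c assume c: "c dvd chebyshev t (Suc (Suc n))" "c dvd chebyshev t (Suc n)"
    then have "c dvd t * chebyshev t (Suc n) - chebyshev t (Suc (Suc n))" by (intro dvd_diff dvd_mult)
    then have "c dvd chebyshev t n" by simp
    with Suc c(2) show "is_unit c" by (rule coprime_common_divisor)
  qed
qed simp

text \<open>Pigeonhole on pairs of consecutive residues. The recurrence can be run backwards, so a
  repetition anywhere moves down to index 0.\<close>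

lemma chebyshev_periodic:
  fixes t d :: int
  assumes "d > 0"
  shows "\<exists>n>0. [chebyshev t n = 0] (mod d) \<and> [chebyshev t (Suc n) = 1] (mod d)"
proof -
  define f where "f n = (chebyshev t n mod d, chebyshev t (Suc n) mod d)" for n
  have "range f \<subseteq> {0..<d} \<times> {0..<d}" using assms by (auto simp: f_def)
  then have "finite (range f)" by (rule finite_subset) simp
  then have "\<not> inj f" using finite_imageD[of f UNIV] by auto
  then obtain i j where "i < j" "f i = f j" by (metis injI linorder_neqE_nat)
  then have "f 0 = f (j - i)"
  proof (induction i arbitrary: j)
    case (Suc i)
    then obtain k where k: "j = Suc k" by (cases j) auto
    have "[chebyshev t (Suc i) = chebyshev t (Suc k)] (mod d)"
      "[chebyshev t (Suc (Suc i)) = chebyshev t (Suc (Suc k))] (mod d)"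
      using Suc.prems by (simp_all only: f_def k cong_def prod.inject)
    then have "[t * chebyshev t (Suc i) - chebyshev t (Suc (Suc i))
        = t * chebyshev t (Suc k) - chebyshev t (Suc (Suc k))] (mod d)"
      by (intro cong_diff cong_mult cong_refl)
    then have "[chebyshev t i = chebyshev t k] (mod d)" by simp
    then have "f i = f k" using Suc.prems by (simp add: f_def k cong_def del: chebyshev.simps)
    then show ?case using Suc.IH[of k] Suc.prems by (simp add: k)
  qed simp
  then show ?thesis using \<open>i < j\<close> by (intro exI[of _ "j - i"]) (auto simp: f_def cong_def)
qed

section \<open>The points of the powers of \<open>R\<^sup>3 S\<close> applied to infinity\<close>

lemma qrat_point_R_mult:
  assumes "z \<noteq> 0" shows "qrat_point z (r + int n * s) s = (move_R z ^^ n) (qrat_point z r s)"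
proof (induction n)
  case (Suc n)
  have "r + int (Suc n) * s = (r + int n * s) + s" by (simp add: algebra_simps)
  then show ?case by (simp only: qrat_point_R[OF assms] Suc funpow.simps o_apply)
qed simp

text \<open>
  The fractions with expansion \<open>[3, \<dots>, 3]\<close>: the normalized trace \<open>[3]\<^sub>q / q\<close> of \<open>R\<^sub>q\<^sup>3 S\<^sub>q\<close> is real
  on the unit circle.
\<close>

lemma qrat_point_chebyshev:
  assumes "z \<noteq> 0" "complex_of_real t = 1 + z + 1 / z" "t \<ge> 2"
  shows "qrat_point z (chebyshev 3 (Suc (Suc n))) (chebyshev 3 (Suc n))
    = Some (z * of_real (chebyshev t (Suc (Suc n))) / of_real (chebyshev t (Suc n)))"
proof -
  \<comment> \<open>One application of R^3 S, which acts on points as w -> 1 + z + z^2 -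
    z^2/w.\<close>
  have step: "qrat_point z (3 * r - s) r = move_R z (move_R z (move_R z (move_S z (qrat_point z r s))))"
    if "r \<noteq> 0" for r s
    using qrat_point_R_mult[OF assms(1), of "- s" 3 r] qrat_point_S[OF assms(1), of r s] that
    by (simp add: numeral_3_eq_3)
  have zt: "z * of_real t = 1 + z + z ^ 2" using assms(1,2) by (simp add: field_simps power2_eq_square)
  show ?thesis
  proof (induction n)
    case 0
    show ?case using step[of 1 0] zt by (simp add: qrat_point_infinity algebra_simps power2_eq_square)
  next
    case (Suc n)
    define u v :: complex where "u = of_real (chebyshev t (Suc (Suc n)))" and "v = of_real (chebyshev t (Suc n))"
    have uv: "u \<noteq> 0" "v \<noteq> 0"
      using chebyshev_pos[OF assms(3), of "Suc (Suc n)"] chebyshev_pos[OF assms(3), of "Suc n"]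
      by (simp_all add: u_def v_def del: chebyshev.simps)
    have w: "complex_of_real (chebyshev t (Suc (Suc (Suc n)))) = of_real t * u - v"
      by (simp only: chebyshev.simps(3)[of t "Suc n"] u_def v_def of_real_diff of_real_mult)
    have "chebyshev (3::int) (Suc (Suc n)) \<noteq> 0"
      using chebyshev_pos[of "3::int" "Suc (Suc n)"] by (simp del: chebyshev.simps)
    from step[OF this, of "chebyshev 3 (Suc n)"]
    have "qrat_point z (chebyshev 3 (Suc (Suc (Suc n)))) (chebyshev 3 (Suc (Suc n)))
      = move_R z (move_R z (move_R z (move_S z (Some (z * u / v)))))"
      by (simp only: Suc.IH chebyshev.simps(3)[of 3 "Suc n"] u_def v_def)
    also have "\<dots> = Some (1 + z + z ^ 2 - z * v / u)"
      using uv assms(1) by (simp add: field_simps power2_eq_square)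
    also have "\<dots> = Some (z * (of_real t * u - v) / u)"
      unfolding zt[symmetric] using uv by (simp add: field_simps)
    finally show ?case by (simp only: w u_def)
  qed
qed

text \<open>On the unit circle 1/z is the conjugate of z, so the trace is 1 + 2 cos(2 pi/d). It is
  at least 2 because the angle is at most pi/3; this is where d \<ge> 6 enters.\<close>

lemma cis_trace_ge_2:
  assumes "d \<ge> 6"
  shows "\<exists>t\<ge>2. complex_of_real t = 1 + cis (2 * pi / real d) + 1 / cis (2 * pi / real d)"
proof (intro exI conjI)
  have "2 * pi / real d \<le> pi / 3" using assms by (simp add: field_simps)
  then have "cos (pi / 3) \<le> cos (2 * pi / real d)" using pi_gt_zero by (intro cos_monotone_0_pi_le) auto
  then show "1 + 2 * cos (2 * pi / real d) \<ge> 2" by (simp add: cos_60)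
  have "1 / cis (2 * pi / real d) = cnj (cis (2 * pi / real d))"
    by (simp add: cis_cnj divide_inverse)
  then show "complex_of_real (1 + 2 * cos (2 * pi / real d))
      = 1 + cis (2 * pi / real d) + 1 / cis (2 * pi / real d)"
    by (simp add: complex_eq_iff)
qed

text \<open>With a period n of the sequence modulo d, the fractions u(n+1)/u(n) and u(n)/u(n-1) have
  the residues (1, 0) and (0, -1), while their points at one primitive root are finite and
  nonzero.\<close>

lemma cyclotomic_not_dvd_large:
  assumes "d \<ge> 6"
  shows "\<exists>r s :: int. coprime r s \<and> s > 0
      \<and> [s = 0] (mod int d) \<and> ([r = 1] (mod int d) \<or> [r = - 1] (mod int d))
      \<and> \<not> laurent_of_poly (cyclotomic d) dvd qden (of_int r / of_int s)"
    and "\<exists>r s :: int. coprime r s \<and> s > 0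
      \<and> [r = 0] (mod int d) \<and> ([s = 1] (mod int d) \<or> [s = - 1] (mod int d))
      \<and> \<not> laurent_of_poly (cyclotomic d) dvd qnum (of_int r / of_int s)"
proof -
  define z where "z = cis (2 * pi / real d)"
  have z: "z \<noteq> 0" by (simp add: z_def)
  have prim: "z \<in> primitive_roots_unity d"
    unfolding z_def using assms by (intro cis_in_primitive_roots_unity) simp
  obtain t where t: "complex_of_real t = 1 + z + 1 / z" "t \<ge> 2"
    using cis_trace_ge_2[OF assms] by (auto simp: z_def)
  define u :: "nat \<Rightarrow> int" where "u = chebyshev 3"
  have u_pos: "u k > 0" if "k > 0" for k using chebyshev_pos[of "3::int" k] that by (simp add: u_def)
  obtain n where n: "n > 0" "[u n = 0] (mod int d)" "[u (Suc n) = 1] (mod int d)"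
    using chebyshev_periodic[of "int d" 3] assms by (auto simp: u_def)
  have "u (Suc 0) = 1" by (simp add: u_def)
  \<comment> \<open>This ensures that the second denominator u(n-1) is positive.\<close>
  then have "n \<noteq> Suc 0" using n(2) assms by (auto simp: cong_def)
  then obtain k where k: "n = Suc (Suc k)" using n(1) by (metis not0_implies_Suc less_numeral_extra(3))
  note point = qrat_point_chebyshev[OF z t, folded u_def]
  have "qrat_point z (u (Suc n)) (u n) \<noteq> None" unfolding k point by simp
  then have "\<not> laurent_of_poly (cyclotomic d) dvd qden (of_int (u (Suc n)) / of_int (u n))"
    using qrat_point_eq_None_iff[of "u n" z] u_pos[OF n(1)] prim assms by (auto simp: cyclotomic_dvd_iff)
  then show "\<exists>r s :: int. coprime r s \<and> s > 0
      \<and> [s = 0] (mod int d) \<and> ([r = 1] (mod int d) \<or> [r = - 1] (mod int d))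
      \<and> \<not> laurent_of_poly (cyclotomic d) dvd qden (of_int r / of_int s)"
    using n u_pos[OF n(1)] coprime_chebyshev[of 3 n] unfolding u_def by blast
  have "chebyshev t (Suc n) \<noteq> 0" "chebyshev t n \<noteq> 0" "chebyshev t (Suc k) \<noteq> 0"
    using chebyshev_pos[OF t(2), of "Suc k"] chebyshev_pos[OF t(2), of n] chebyshev_pos[OF t(2), of "Suc n"]
      n(1) by (simp_all del: chebyshev.simps)
  then have "qrat_point z (u n) (u (Suc k)) \<noteq> Some 0" using z unfolding k point by (simp del: chebyshev.simps)
  then have nd: "\<not> laurent_of_poly (cyclotomic d) dvd qnum (of_int (u n) / of_int (u (Suc k)))"
    using qrat_point_eq_zero_iff[OF z, of "u (Suc k)"] u_pos[of "Suc k"] prim assms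
    by (auto simp: cyclotomic_dvd_iff)
  \<comment> \<open>The recurrence solved for u(n-1).\<close>
  have "[3 * u n - u (Suc n) = 3 * 0 - 1] (mod int d)" using n by (intro cong_diff cong_mult cong_refl)
  then have "[u (Suc k) = - 1] (mod int d)" by (simp add: k u_def)
  then show "\<exists>r s :: int. coprime r s \<and> s > 0
      \<and> [r = 0] (mod int d) \<and> ([s = 1] (mod int d) \<or> [s = - 1] (mod int d))
      \<and> \<not> laurent_of_poly (cyclotomic d) dvd qnum (of_int r / of_int s)"
    using nd n(2) u_pos[of "Suc k"] coprime_chebyshev[of 3 "Suc k"] unfolding u_def k by blast
qed

subsection \<open>The index of \<open>\<langle>R\<rangle> N\<^sub>d\<close>\<close>

lemma move_R_inj: "z \<noteq> 0 \<Longrightarrow> move_R z w = move_R z w' \<longleftrightarrow> w = w'"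
  by (cases w; cases w') auto

lemma move_R_eq_None: "move_R z w = None \<longleftrightarrow> w = None"
  by (cases w) auto

lemma move_R_power:
  "(move_R z ^^ n) w = (case w of None \<Rightarrow> None | Some x \<Rightarrow> Some (z ^ n * x + (\<Sum>i<n. z ^ i)))"
proof (induction n)
  case (Suc n)
  have "(\<Sum>i<Suc n. z ^ i) = 1 + z * (\<Sum>i<n. z ^ i)"
    by (subst sum.lessThan_Suc_shift) (simp add: sum_distrib_left)
  then show ?case by (simp add: Suc algebra_simps split: option.split del: sum.lessThan_Suc)
qed (simp split: option.split)

lemma move_R_power_root_of_unity:
  assumes "z ^ d = 1" "z \<noteq> 1" shows "(move_R z ^^ d) w = w"
  using assms by (simp add: move_R_power sum_gp_strict split: option.split)

text \<open>Negative shifts follow from the injectivity of \<open>move_R\<close>.\<close>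

lemma qrat_point_R_cong:
  assumes "z \<noteq> 0" "qrat_point z r s = qrat_point z r' s'"
  shows "qrat_point z (r + k * s) s = qrat_point z (r' + k * s') s'"
proof (induction k rule: int_induct[of _ 0])
  case base
  show ?case using assms by simp
next
  case (step1 i)
  have "r + (i + 1) * s = (r + i * s) + s" for r s :: int by (simp add: algebra_simps)
  then show ?case by (simp only: qrat_point_R[OF assms(1)] step1)
next
  case (step2 i)
  have "r + i * s = (r + (i - 1) * s) + s" for r s :: int by (simp add: algebra_simps)
  then show ?case using step2(2) by (simp only: qrat_point_R[OF assms(1)] move_R_inj[OF assms(1)])
qed

text \<open>Multiplication by the adjugate recovers the vector. This keeps all pairs away from (0,
  0), where equivariance under S fails.\<close>

lemma det_1_nonzero:
  fixes a b c e r s :: int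
  assumes "a * e - b * c = 1" "r \<noteq> 0 \<or> s \<noteq> 0"
  shows "a * r + b * s \<noteq> 0 \<or> c * r + e * s \<noteq> 0"
proof (rule ccontr)
  assume "\<not> ?thesis"
  then have "e * (a * r + b * s) - b * (c * r + e * s) = 0" "a * (c * r + e * s) - c * (a * r + b * s) = 0"
    by simp_all
  then have "(a * e - b * c) * r = 0" "(a * e - b * c) * s = 0" by (simp_all add: algebra_simps)
  with assms show False by simp
qed

text \<open>Makes the action of the modular group on points well defined without writing down
  deformed matrices. The induction runs over the first column: R and S are split off on the left,
  and the column (1, 0) leaves a power of R.\<close>

lemma qrat_point_cong:
  fixes a b c e r s r' s' :: int
  assumes "z \<noteq> 0" "a * e - b * c = 1" "r \<noteq> 0 \<or> s \<noteq> 0" "r' \<noteq> 0 \<or> s' \<noteq> 0"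
    and "qrat_point z r s = qrat_point z r' s'"
  shows "qrat_point z (a * r + b * s) (c * r + e * s) = qrat_point z (a * r' + b * s') (c * r' + e * s')"
proof -
  have "is_unit k" if "k dvd a" "k dvd c" for k
    unfolding assms(2)[symmetric] using that by (intro dvd_diff dvd_mult dvd_mult2)
  then have "coprime a c" by (rule coprimeI)
  then show ?thesis using assms(2)
  proof (induction arbitrary: b e rule: coprime_pair_induct)
    case infinity
    then show ?case using qrat_point_R_cong[OF assms(1,5), of b] by simp
  next
    case (R a c)
    have "a * e - (b - e) * c = 1" using R.prems by (simp add: algebra_simps)
    from arg_cong[OF R.IH[OF this], of "move_R z"] show ?case
      unfolding qrat_point_R[OF assms(1), symmetric] by (simp add: algebra_simps)
  next
    case (S a c)
    have det: "a * (- b) - e * c = 1" using S.prems by (simp add: algebra_simps)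
    from arg_cong[OF S.IH[OF det], of "move_S z"] show ?case
      unfolding qrat_point_S[OF assms(1) det_1_nonzero[OF det assms(3)], symmetric]
        qrat_point_S[OF assms(1) det_1_nonzero[OF det assms(4)], symmetric]
      by (simp add: algebra_simps)
  qed
qed

section \<open>The action of PSL(2,Z) on points\<close>

definition vec_point :: "complex \<Rightarrow> int^2 \<Rightarrow> complex option" where
  "vec_point z x = qrat_point z (x $ 1) (x $ 2)"

lemma matrix_vector_mult_2:
  "(A *v x) $ i = A $ i $ 1 * x $ 1 + A $ i $ 2 * x $ 2" for A :: "int^2^2"
  by (simp add: matrix_vector_mult_def sum_2)

lemma vec_2_nonzero: "x \<noteq> 0 \<longleftrightarrow> x $ 1 \<noteq> 0 \<or> x $ 2 \<noteq> 0" for x :: "int^2"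
  by (auto simp: vec_eq_iff forall_2)

lemma vec_point_minus: "vec_point z (- x) = vec_point z x"
  by (simp add: vec_point_def qrat_point_minus)

lemma vec_point_cong:
  assumes "z \<noteq> 0" "det A = 1" "x \<noteq> 0" "y \<noteq> 0" "vec_point z x = vec_point z y"
  shows "vec_point z (A *v x) = vec_point z (A *v y)"
  using assms unfolding vec_point_def matrix_vector_mult_2 vec_2_nonzero det_2
  by (intro qrat_point_cong) (auto simp: mult.commute)

lemma det_1_mult_nonzero: "det A = 1 \<Longrightarrow> x \<noteq> 0 \<Longrightarrow> A *v x \<noteq> 0" for A :: "int^2^2"
  using det_1_nonzero[of "A$1$1" "A$2$2" "A$1$2" "A$2$1" "x$1" "x$2"]
  unfolding vec_2_nonzero matrix_vector_mult_2 det_2 by simp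

lemma PSL2Z_memD:
  assumes "X \<in> carrier PSL2Z" "A \<in> X"
  shows "det A = 1" "X = {A, - A}"
proof -
  obtain B where B: "det B = 1" "X = {mat 1, - mat 1} #>\<^bsub>SL2Z\<^esub> B"
    using assms(1) by (auto simp: PSL2Z_def FactGroup_def RCOSETS_def SL2Z_def)
  have "X = {B, - B}"
    unfolding B(2)
    by (auto simp: r_coset_def SL2Z_def vec_eq_iff forall_2 matrix_matrix_mult_def sum_2 mat_def)
  then show "det A = 1" "X = {A, - A}" using assms(2) B(1) by (auto simp: det_uminus_2)
qed

lemma PSL2Z_nonempty: "X \<in> carrier PSL2Z \<Longrightarrow> X \<noteq> {}"
  unfolding PSL2Z_def FactGroup_def RCOSETS_def r_coset_def by auto

lemma PSL2Z_mult: "X \<otimes>\<^bsub>PSL2Z\<^esub> Y = {A ** B | A B. A \<in> X \<and> B \<in> Y}"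
  by (auto simp: PSL2Z_def FactGroup_def set_mult_def SL2Z_def)

lemma PSL2Z_mult_closed:
  "X \<in> carrier PSL2Z \<Longrightarrow> Y \<in> carrier PSL2Z \<Longrightarrow> {A ** B | A B. A \<in> X \<and> B \<in> Y} \<in> carrier PSL2Z"
  using monoid.m_closed[OF group.is_monoid[OF group_PSL2Z], of X Y] by (simp add: PSL2Z_mult)

lemma PSL2Z_one: "\<one>\<^bsub>PSL2Z\<^esub> = {mat 1, - mat 1}"
  by (simp add: PSL2Z_def FactGroup_def)

lemma vec_point_one: "A \<in> \<one>\<^bsub>PSL2Z\<^esub> \<Longrightarrow> vec_point z (A *v x) = vec_point z x"
  by (auto simp: PSL2Z_one vec_point_def matrix_vector_mult_2 mat_def qrat_point_minus)

lemma vec_point_inv_mult: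
  assumes "X \<in> carrier PSL2Z" "A \<in> X" "B \<in> inv\<^bsub>PSL2Z\<^esub> X"
  shows "vec_point z (A *v (B *v x)) = vec_point z x"
proof -
  interpret group PSL2Z by (rule group_PSL2Z)
  have "A ** B \<in> \<one>\<^bsub>PSL2Z\<^esub>" using r_inv[OF assms(1)] assms by (auto simp: PSL2Z_mult)
  then show ?thesis by (simp only: vec_point_one matrix_vector_mul_assoc)
qed

text \<open>Membership in the carrier is built in and all representatives are quantified over, so
  that the property passes through the induction over \<open>generate\<close>.\<close>

definition fixes_points :: "complex \<Rightarrow> (int^2^2) set \<Rightarrow> bool" where
  "fixes_points z X \<longleftrightarrow> X \<in> carrier PSL2Z \<and> (\<forall>A\<in>X. \<forall>x. x \<noteq> 0 \<longrightarrow> vec_point z (A *v x) = vec_point z x)"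

definition fixes_infinity :: "complex \<Rightarrow> (int^2^2) set \<Rightarrow> bool" where
  "fixes_infinity z X \<longleftrightarrow> X \<in> carrier PSL2Z
     \<and> (\<forall>A\<in>X. \<forall>x. x \<noteq> 0 \<longrightarrow> vec_point z x = None \<longrightarrow> vec_point z (A *v x) = None)"

lemma R_PSL_mem: "A \<in> R_PSL \<Longrightarrow> z \<noteq> 0 \<Longrightarrow> vec_point z (A *v x) = move_R z (vec_point z x)"
proof -
  assume A: "A \<in> R_PSL" and z: "z \<noteq> 0"
  define R :: "int^2^2" where "R = vector [vector [1, 1], vector [0, 1]]"
  have "R \<in> R_PSL" unfolding R_PSL_def R_def by (auto simp: r_coset_def SL2Z_def)
  from PSL2Z_memD(2)[OF R_PSL_in_carrier this] A have "A = R \<or> A = - R" by auto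
  moreover have "vec_point z (R *v x) = move_R z (vec_point z x)"
    using qrat_point_R[OF z] by (simp add: vec_point_def matrix_vector_mult_2 R_def)
  moreover have "- R *v x = - (R *v x)"
    by (simp add: vec_eq_iff matrix_vector_mult_2)
  ultimately show ?thesis by (auto simp: vec_point_minus)
qed

lemma R_PSL_power_mem:
  assumes "z \<noteq> 0"
  shows "A \<in> R_PSL [^]\<^bsub>PSL2Z\<^esub> (n::nat) \<Longrightarrow> vec_point z (A *v x) = (move_R z ^^ n) (vec_point z x)"
proof (induction n arbitrary: A x)
  case 0
  then show ?case by (simp add: vec_point_one)
next
  case (Suc n)
  then obtain B C where "A = B ** C" "B \<in> R_PSL [^]\<^bsub>PSL2Z\<^esub> n" "C \<in> R_PSL"
    by (auto simp: PSL2Z_mult)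
  then show ?case
    by (simp add: Suc.IH R_PSL_mem[OF _ assms] funpow_swap1 flip: matrix_vector_mul_assoc)
qed

text \<open>R^d acts trivially because the geometric sum of \<open>z\<close> over a full period
  vanishes. Acting trivially is preserved by conjugation, inverses and products.\<close>

lemma N_sub_fixes_points:
  assumes "z ^ d = 1" "z \<noteq> 1" "d > 0" "X \<in> N_sub d"
  shows "fixes_points z X"
proof -
  interpret group PSL2Z by (rule group_PSL2Z)
  have z: "z \<noteq> 0" using assms by (auto simp: power_0_left)
  have Rd: "R_PSL [^]\<^bsub>PSL2Z\<^esub> d \<in> carrier PSL2Z" using R_PSL_in_carrier by simp
  have conj: "fixes_points z (g \<otimes>\<^bsub>PSL2Z\<^esub> R_PSL [^]\<^bsub>PSL2Z\<^esub> d \<otimes>\<^bsub>PSL2Z\<^esub> inv\<^bsub>PSL2Z\<^esub> g)"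
    if g: "g \<in> carrier PSL2Z" for g
    unfolding fixes_points_def
  proof (intro conjI ballI allI impI)
    show "g \<otimes>\<^bsub>PSL2Z\<^esub> R_PSL [^]\<^bsub>PSL2Z\<^esub> d \<otimes>\<^bsub>PSL2Z\<^esub> inv\<^bsub>PSL2Z\<^esub> g \<in> carrier PSL2Z" using g Rd by simp
    fix A and x :: "int^2"
    assume "A \<in> g \<otimes>\<^bsub>PSL2Z\<^esub> R_PSL [^]\<^bsub>PSL2Z\<^esub> d \<otimes>\<^bsub>PSL2Z\<^esub> inv\<^bsub>PSL2Z\<^esub> g" and x: "x \<noteq> 0"
    then obtain B C B' where A: "A = B ** C ** B'" and B: "B \<in> g" and C: "C \<in> R_PSL [^]\<^bsub>PSL2Z\<^esub> d"
      and B': "B' \<in> inv\<^bsub>PSL2Z\<^esub> g"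
      by (auto simp: PSL2Z_mult)
    have det: "det B = 1" "det C = 1" "det B' = 1"
      using PSL2Z_memD(1) g Rd B C B' by blast+
    define y where "y = B' *v x"
    have y: "y \<noteq> 0" unfolding y_def using det x by (simp add: det_1_mult_nonzero)
    have "vec_point z (C *v y) = vec_point z y"
      by (simp add: R_PSL_power_mem[OF z C] move_R_power_root_of_unity[OF assms(1,2)])
    \<comment> \<open>Vectors with the same point are carried to vectors with the same point; this
      is what handles the conjugation.\<close>
    then have "vec_point z (B *v (C *v y)) = vec_point z (B *v y)"
      using z det y by (intro vec_point_cong) (simp_all add: det_1_mult_nonzero)
    also have "\<dots> = vec_point z x" unfolding y_def using g B B' by (rule vec_point_inv_mult)
    finally show "vec_point z (A *v x) = vec_point z x"
      by (simp add: A y_def flip: matrix_vector_mul_assoc)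
  qed
  have fixes_inv: "fixes_points z (inv\<^bsub>PSL2Z\<^esub> X)" if X: "fixes_points z X" for X
    unfolding fixes_points_def
  proof (intro conjI ballI allI impI)
    have Xc: "X \<in> carrier PSL2Z" using X by (simp add: fixes_points_def)
    then show "inv\<^bsub>PSL2Z\<^esub> X \<in> carrier PSL2Z" by simp
    fix B and x :: "int^2" assume B: "B \<in> inv\<^bsub>PSL2Z\<^esub> X" and "x \<noteq> 0"
    then have "B *v x \<noteq> 0"
      using PSL2Z_memD(1)[OF inv_closed[OF Xc] B] by (simp add: det_1_mult_nonzero)
    moreover obtain A where A: "A \<in> X" using PSL2Z_nonempty[OF Xc] by auto
    ultimately have "vec_point z (A *v (B *v x)) = vec_point z (B *v x)" 
      using X by (simp add: fixes_points_def)
    then show "vec_point z (B *v x) = vec_point z x" using vec_point_inv_mult[OF Xc A B] by simp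
  qed
  show ?thesis using assms(4) unfolding N_sub_def normal_closure_def
  proof (induction rule: generate.induct)
    case one
    then show ?case by (simp add: fixes_points_def vec_point_one)
  next
    case (incl h)
    then show ?case using conj by auto
  next
    case (inv h)
    then show ?case using conj fixes_inv by blast
  next
    case (eng h1 h2)
    have "h2 \<in> carrier PSL2Z" using eng by (simp add: fixes_points_def)
    then have "A *v x \<noteq> 0" if "A \<in> h2" "x \<noteq> 0" for A x
      using that PSL2Z_memD(1) by (intro det_1_mult_nonzero)
    then show ?case using eng unfolding fixes_points_def
      by (auto simp: PSL2Z_mult PSL2Z_mult_closed simp flip: matrix_vector_mul_assoc)
  qed
qed

text \<open>R both preserves and reflects infinity; the latter handles its inverse.\<close>

lemma generate_R_fixes_infinity:
  assumes "z \<noteq> 0" "X \<in> generate PSL2Z {R_PSL}"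
  shows "fixes_infinity z X"
proof -
  interpret group PSL2Z by (rule group_PSL2Z)
  note R = R_PSL_in_carrier R_PSL_mem[OF _ assms(1)] move_R_eq_None
  show ?thesis using assms(2)
  proof (induction rule: generate.induct)
    case one
    then show ?case by (simp add: fixes_infinity_def vec_point_one)
  next
    case (incl h)
    then show ?case by (simp add: fixes_infinity_def R)
  next
    case (inv h)
    then have h: "h = R_PSL" by simp
    obtain A where A: "A \<in> R_PSL" using PSL2Z_nonempty[OF R(1)] by auto
    show ?case unfolding fixes_infinity_def h
    proof (intro conjI ballI allI impI)
      show "inv\<^bsub>PSL2Z\<^esub> R_PSL \<in> carrier PSL2Z" using R(1) by simp
      fix B x assume "B \<in> inv\<^bsub>PSL2Z\<^esub> R_PSL" "vec_point z x = None"
      then have "move_R z (vec_point z (B *v x)) = None"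
        using vec_point_inv_mult[OF R(1) A, of B z x] by (simp add: R(2)[OF A])
      then show "vec_point z (B *v x) = None" by (simp add: move_R_eq_None)
    qed
  next
    case (eng h1 h2)
    have "h2 \<in> carrier PSL2Z" using eng by (simp add: fixes_infinity_def)
    then have "A *v x \<noteq> 0" if "A \<in> h2" "x \<noteq> 0" for A x
      using that PSL2Z_memD(1) by (intro det_1_mult_nonzero)
    then show ?case using eng unfolding fixes_infinity_def
      by (auto simp: PSL2Z_mult PSL2Z_mult_closed simp flip: matrix_vector_mul_assoc)
  qed
qed

lemma infinite_index:
  assumes "d \<ge> 6"
  shows "infinite (rcosets\<^bsub>PSL2Z\<^esub> (generate PSL2Z {R_PSL} <#>\<^bsub>PSL2Z\<^esub> N_sub d))"
proof
  interpret group PSL2Z by (rule group_PSL2Z)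
  define H where "H = generate PSL2Z {R_PSL} <#>\<^bsub>PSL2Z\<^esub> N_sub d"
  assume "finite (rcosets\<^bsub>PSL2Z\<^esub> (generate PSL2Z {R_PSL} <#>\<^bsub>PSL2Z\<^esub> N_sub d))"
  then have fin: "finite (rcosets\<^bsub>PSL2Z\<^esub> H)" by (simp add: H_def)
  define z where "z = cis (2 * pi / real d)"
  have "z \<in> primitive_roots_unity d"
    unfolding z_def using assms by (intro cis_in_primitive_roots_unity) simp
  then have z: "z \<noteq> 0" "z ^ d = 1" "z \<noteq> 1"
    using assms power_one_right[of z] by (auto simp: z_def primitive_roots_unity_def dest: spec[of _ 1])
  obtain t where t: "complex_of_real t = 1 + z + 1 / z" "t \<ge> 2"
    using cis_trace_ge_2[OF assms] by (auto simp: z_def)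
  define e :: "int^2" where "e = vector [1, 0]"
  have e: "e \<noteq> 0" "vec_point z e = None"
    by (simp_all add: e_def vec_2_nonzero vec_point_def qrat_point_infinity)
  \<comment> \<open>The factor from \<open>N_sub d\<close> acts first and leaves the point in place,
    then the power of R keeps it at infinity.\<close>
  have H: "X \<in> carrier PSL2Z \<and> (\<forall>A\<in>X. vec_point z (A *v e) = None)" if X: "X \<in> H" for X
  proof -
    obtain g h where X: "X = g \<otimes>\<^bsub>PSL2Z\<^esub> h" "g \<in> generate PSL2Z {R_PSL}" "h \<in> N_sub d"
      using X by (auto simp: H_def set_mult_def)
    have g: "fixes_infinity z g" using z(1) X(2) by (rule generate_R_fixes_infinity)
    have h: "fixes_points z h" using z X(3) assms by (intro N_sub_fixes_points) auto
    have "vec_point z (A *v (B *v e)) = None" if "A \<in> g" "B \<in> h" for A B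
    proof -
      have "vec_point z (B *v e) = None" "B *v e \<noteq> 0"
        using h e that PSL2Z_memD(1)[of h B] by (simp_all add: fixes_points_def det_1_mult_nonzero)
      then show ?thesis using g that by (simp add: fixes_infinity_def)
    qed
    then show ?thesis using g h
      by (auto simp: X(1) PSL2Z_mult PSL2Z_mult_closed fixes_infinity_def fixes_points_def simp flip: matrix_vector_mul_assoc)
  qed
  have "\<one>\<^bsub>PSL2Z\<^esub> \<otimes>\<^bsub>PSL2Z\<^esub> \<one>\<^bsub>PSL2Z\<^esub> \<in> H"
    unfolding H_def N_sub_def normal_closure_def set_mult_def by (blast intro: generate.one)
  then have one: "\<one>\<^bsub>PSL2Z\<^esub> \<in> H" by simp
  \<comment> \<open>The matrix of R^3 S; its powers send (1, 0) to consecutive terms of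
    \<open>chebyshev 3\<close>.\<close>
  define C :: "int^2^2" where "C = vector [vector [3, - 1], vector [1, 0]]"
  define c where "c = {mat 1, - mat 1} #>\<^bsub>SL2Z\<^esub> C"
  have "C \<in> carrier SL2Z" by (simp add: SL2Z_def C_def det_2)
  then have c: "c \<in> carrier PSL2Z" unfolding c_def PSL2Z_def FactGroup_def RCOSETS_def by auto
  have "C \<in> c" unfolding c_def by (auto simp: r_coset_def SL2Z_def)
  then have cC: "c = {C, - C}" using PSL2Z_memD(2)[OF c] by blast
  define u :: "nat \<Rightarrow> int^2" where "u n = vector [chebyshev 3 (Suc n), chebyshev 3 n]" for n
  have Cu: "C *v u n = u (Suc n)" for n
    by (simp add: u_def C_def vec_eq_iff forall_2 matrix_vector_mult_2)
  have neg: "(- A) *v x = - (A *v x)" "A *v (- x) = - (A *v x)" for A :: "int^2^2" and x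
    by (simp_all add: vec_eq_iff matrix_vector_mult_2)
  have pow: "A *v e = u n \<or> A *v e = - u n" if "A \<in> c [^]\<^bsub>PSL2Z\<^esub> n" for A and n :: nat
    using that
  proof (induction n arbitrary: A)
    case 0
    have "u 0 = e" by (simp add: u_def e_def)
    then show ?case using 0 by (auto simp: PSL2Z_one neg)
  next
    case (Suc n)
    then obtain B A' where A: "A = B ** A'" "B \<in> c" "A' \<in> c [^]\<^bsub>PSL2Z\<^esub> n"
      unfolding nat_pow_Suc2[OF c] PSL2Z_mult by blast
    have "B = C \<or> B = - C" using A(2) cC by auto
    then show ?case using Suc.IH[OF A(3)] by (auto simp: A(1) neg Cu simp flip: matrix_vector_mul_assoc)
  qed
  have not_None: "vec_point z (A *v e) \<noteq> None" if A: "A \<in> c [^]\<^bsub>PSL2Z\<^esub> n" and n: "n > 0" for A and n :: nat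
  proof -
    obtain k where k: "n = Suc k" using n by (cases n) auto
    have "vec_point z (u n) \<noteq> None"
      using qrat_point_chebyshev[OF z(1) t, of k] by (simp add: k vec_point_def u_def del: chebyshev.simps)
    then show ?thesis using pow[OF A] by (auto simp: vec_point_minus)
  qed
  define f where "f n = H #>\<^bsub>PSL2Z\<^esub> (c [^]\<^bsub>PSL2Z\<^esub> n)" for n :: nat
  have "range f \<subseteq> rcosets\<^bsub>PSL2Z\<^esub> H" using c by (auto simp: f_def RCOSETS_def)
  then have "finite (range f)" using fin by (rule finite_subset)
  then have "\<not> inj f" using finite_imageD[of f UNIV] by auto
  then obtain i j where ij: "i < j" "f i = f j" by (metis injI linorder_neqE_nat)
  \<comment> \<open>Equal cosets put a positive power of R^3 S into \<open>H\<close>, whose elements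
    send (1, 0) to infinity, whereas that power sends it to a finite point.\<close>
  have "\<one>\<^bsub>PSL2Z\<^esub> \<otimes>\<^bsub>PSL2Z\<^esub> c [^]\<^bsub>PSL2Z\<^esub> j \<in> f j" using one unfolding f_def r_coset_def by blast
  then have "c [^]\<^bsub>PSL2Z\<^esub> j \<in> f i" using ij c by simp
  then obtain h where h: "h \<in> H" "c [^]\<^bsub>PSL2Z\<^esub> j = h \<otimes>\<^bsub>PSL2Z\<^esub> c [^]\<^bsub>PSL2Z\<^esub> i"
    unfolding f_def r_coset_def by blast
  have "c [^]\<^bsub>PSL2Z\<^esub> j = c [^]\<^bsub>PSL2Z\<^esub> (j - i) \<otimes>\<^bsub>PSL2Z\<^esub> c [^]\<^bsub>PSL2Z\<^esub> i"
    using nat_pow_mult[OF c, of "j - i" i] ij(1) by simp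
  then have "h = c [^]\<^bsub>PSL2Z\<^esub> (j - i)" using h H[OF h(1)] c by (metis nat_pow_closed right_cancel)
  moreover obtain A where "A \<in> h" using H[OF h(1)] PSL2Z_nonempty by blast
  ultimately show False using H[OF h(1)] not_None[of A "j - i"] ij(1) by auto
qed

theorem corollary1p4:
  fixes d :: nat
  assumes "d \<ge> 2"
  shows "(d \<le> 5 \<longrightarrow>
      (\<forall>r s :: int. coprime r s \<and> s > 0 \<longrightarrow>
        (laurent_of_poly (cyclotomic d) dvd qden (of_int r / of_int s)
           \<longleftrightarrow> [s = 0] (mod int d) \<and> ([r = 1] (mod int d) \<or> [r = - 1] (mod int d)))
        \<and> (d \<le> 4 \<longrightarrow>
            (laurent_of_poly (cyclotomic d) dvd qden (of_int r / of_int s) \<longleftrightarrow> int d dvd s))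
        \<and> (laurent_of_poly (cyclotomic d) dvd qnum (of_int r / of_int s)
           \<longleftrightarrow> [r = 0] (mod int d) \<and> ([s = 1] (mod int d) \<or> [s = - 1] (mod int d)))
        \<and> (d \<le> 4 \<longrightarrow>
            (laurent_of_poly (cyclotomic d) dvd qnum (of_int r / of_int s) \<longleftrightarrow> int d dvd r))))
    \<and> (d \<ge> 6 \<longrightarrow>
      infinite (rcosets\<^bsub>PSL2Z\<^esub> (generate PSL2Z {R_PSL} <#>\<^bsub>PSL2Z\<^esub> N_sub d))
      \<and> (\<exists>r s :: int. coprime r s \<and> s > 0
           \<and> [s = 0] (mod int d) \<and> ([r = 1] (mod int d) \<or> [r = - 1] (mod int d))
           \<and> \<not> laurent_of_poly (cyclotomic d) dvd qden (of_int r / of_int s))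
      \<and> (\<exists>r s :: int. coprime r s \<and> s > 0
           \<and> [r = 0] (mod int d) \<and> ([s = 1] (mod int d) \<or> [s = - 1] (mod int d))
           \<and> \<not> laurent_of_poly (cyclotomic d) dvd qnum (of_int r / of_int s)))"
  using assms cyclotomic_dvd_small[of d] infinite_index[of d] cyclotomic_not_dvd_large[of d]
  by blast

end
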